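(* Let $R$ be a Noetherian commutative ring, let $f, g \in R[\![X]\!]$ with $g \neq 0$, and let $k$ be the maximum of the numbers $\mu(c(g)_{\mathfrak{m}})$, taken over all maximal ideals $\mathfrak{m}$ of $R$. Then $c(fg)$ is a reduction of $c(f)c(g)$, with reduction number at most $k-1$.
   Context: All rings are commutative with identity. For a power series $f \in R[\![X]\!]$ (in one variable $X$), the content $c(f)$ is the ideal of $R$ generated by all the coefficients of $f$. For a finitely generated ideal $I$, $\mu(I)$ denotes the minimal number of generators of $I$; $c(g)_{\mathfrak{m}}$ is the localization of $c(g)$ at $\mathfrak{m}$, an ideal of $R_{\mathfrak{m}}$. For ideals $J \subseteq I$ of $R$, $J$ is a reduction of $I$ if there is some integer $r \geq 0$ with $I^{r+1} = J I^r$; the least such $r$ is the reduction number (of $I$ with respect to $J$). The zeroth power of any ideal of $R$ is $R$. *)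

theory Defs
  imports
    "HOL-Algebra.Algebraic_Closure_Type"
    "HOL-Algebra.Ideal_Product"
    "HOL-Algebra.Ring_Divisibility"
    "HOL-Computational_Algebra.Formal_Power_Series"
begin

text \<open>
  The ambient ring is a type of class \<^class>\<open>comm_ring_1\<close>, so that power series are the library's
  \<open>fps\<close>. Its ideals are those of HOL-Algebra, for the record \<^const>\<open>ring_of_type_algebra\<close> with
  carrier \<^const>\<open>UNIV\<close>. The class excludes only the zero ring, over which no power series is nonzero.
\<close>

definition fps_content :: "'a::comm_ring_1 fps \<Rightarrow> 'a set" where
  "fps_content f = genideal ring_of_type_algebra (range (fps_nth f))"

definition loc_rel :: "('a, 'b) ring_scheme \<Rightarrow> 'a set \<Rightarrow> (('a \<times> 'a) \<times> ('a \<times> 'a)) set" where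
  "loc_rel R S = {((a, s), (b, t)). a \<in> carrier R \<and> s \<in> S \<and> b \<in> carrier R \<and> t \<in> S \<and>
     (\<exists>u\<in>S. u \<otimes>\<^bsub>R\<^esub> (a \<otimes>\<^bsub>R\<^esub> t \<ominus>\<^bsub>R\<^esub> b \<otimes>\<^bsub>R\<^esub> s) = \<zero>\<^bsub>R\<^esub>)}"

definition loc_frac :: "('a, 'b) ring_scheme \<Rightarrow> 'a set \<Rightarrow> 'a \<Rightarrow> 'a \<Rightarrow> ('a \<times> 'a) set" where
  "loc_frac R S a s = loc_rel R S `` {(a, s)}"

text \<open>
  The sets \<open>\<Union>(a, s)\<in>x. \<Union>(b, t)\<in>y. \<dots>\<close> below are unions of equal classes, by the lemmas
  \<open>localization_mult\<close> and \<open>localization_add\<close>.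
\<close>

definition localization :: "('a, 'b) ring_scheme \<Rightarrow> 'a set \<Rightarrow> ('a \<times> 'a) set ring" where
  "localization R S = \<lparr>
     carrier = (carrier R \<times> S) // loc_rel R S,
     monoid.mult = (\<lambda>x y. \<Union>(a, s)\<in>x. \<Union>(b, t)\<in>y. loc_frac R S (a \<otimes>\<^bsub>R\<^esub> b) (s \<otimes>\<^bsub>R\<^esub> t)),
     one = loc_frac R S \<one>\<^bsub>R\<^esub> \<one>\<^bsub>R\<^esub>,
     ring.zero = loc_frac R S \<zero>\<^bsub>R\<^esub> \<one>\<^bsub>R\<^esub>,
     add = (\<lambda>x y. \<Union>(a, s)\<in>x. \<Union>(b, t)\<in>y.
       loc_frac R S (a \<otimes>\<^bsub>R\<^esub> t \<oplus>\<^bsub>R\<^esub> b \<otimes>\<^bsub>R\<^esub> s) (s \<otimes>\<^bsub>R\<^esub> t))\<rparr>"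

definition loc_ideal :: "('a, 'b) ring_scheme \<Rightarrow> 'a set \<Rightarrow> 'a set \<Rightarrow> ('a \<times> 'a) set set" where
  "loc_ideal R S I = {loc_frac R S a s | a s. a \<in> I \<and> s \<in> S}"

abbreviation localization_at :: "('a, 'b) ring_scheme \<Rightarrow> 'a set \<Rightarrow> ('a \<times> 'a) set ring" where
  "localization_at R m \<equiv> localization R (carrier R - m)"

abbreviation ideal_at :: "('a, 'b) ring_scheme \<Rightarrow> 'a set \<Rightarrow> 'a set \<Rightarrow> ('a \<times> 'a) set set" where
  "ideal_at R m I \<equiv> loc_ideal R (carrier R - m) I"

lemma UN_classes_eq:
  assumes "\<And>a s b t. (a, s) \<in> x \<Longrightarrow> (b, t) \<in> y \<Longrightarrow> h a s b t = c" "(a, s) \<in> x" "(b, t) \<in> y"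
  shows "(\<Union>(a, s)\<in>x. \<Union>(b, t)\<in>y. h a s b t) = c"
proof -
  have "(\<Union>(a, s)\<in>x. \<Union>(b, t)\<in>y. h a s b t) = (\<Union>p\<in>x. \<Union>q\<in>y. c)"
    using assms(1) by (intro SUP_cong refl) auto
  then show ?thesis
    using assms(2,3) by auto
qed

locale mult_submonoid = cring R + submonoid S R for R (structure) and S
begin

lemma S_carr [simp, intro]: "s \<in> S \<Longrightarrow> s \<in> carrier R"
  using subset by blast

lemma loc_rel_iff:
  "((a, s), (b, t)) \<in> loc_rel R S \<longleftrightarrow> a \<in> carrier R \<and> s \<in> S \<and> b \<in> carrier R \<and> t \<in> S \<and>
     (\<exists>u\<in>S. u \<otimes> (a \<otimes> t) = u \<otimes> (b \<otimes> s))"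
proof -
  have "u \<otimes> (a \<otimes> t \<ominus> b \<otimes> s) = \<zero> \<longleftrightarrow> u \<otimes> (a \<otimes> t) = u \<otimes> (b \<otimes> s)"
    if "u \<in> S" "a \<in> carrier R" "s \<in> S" "b \<in> carrier R" "t \<in> S" for u
  proof -
    have "u \<otimes> (a \<otimes> t \<ominus> b \<otimes> s) = u \<otimes> (a \<otimes> t) \<ominus> u \<otimes> (b \<otimes> s)"
      using that by (simp add: minus_eq r_distr r_minus)
    then show ?thesis
      using that by (simp add: r_right_minus_eq)
  qed
  then show ?thesis
    unfolding loc_rel_def by auto
qed

lemma equiv_loc_rel: "equiv (carrier R \<times> S) (loc_rel R S)"
proof (rule equivI)
  show "loc_rel R S \<subseteq> (carrier R \<times> S) \<times> (carrier R \<times> S)"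
    unfolding loc_rel_def by auto
  show "refl_on (carrier R \<times> S) (loc_rel R S)"
    by (rule refl_onI) (auto simp: loc_rel_iff)
  show "sym (loc_rel R S)"
    by (rule symI) (auto simp: loc_rel_iff, metis)
  show "trans (loc_rel R S)"
  proof (rule transI, clarify)
    fix a s b t c r
    assume 1: "((a, s), (b, t)) \<in> loc_rel R S" and 2: "((b, t), (c, r)) \<in> loc_rel R S"
    then obtain u v where uv: "u \<in> S" "v \<in> S"
      "u \<otimes> (a \<otimes> t) = u \<otimes> (b \<otimes> s)" "v \<otimes> (b \<otimes> r) = v \<otimes> (c \<otimes> t)"
      by (auto simp: loc_rel_iff)
    have cl: "a \<in> carrier R" "s \<in> S" "b \<in> carrier R" "t \<in> S" "c \<in> carrier R" "r \<in> S"
      using 1 2 by (auto simp: loc_rel_iff)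
    have "(u \<otimes> v \<otimes> t) \<otimes> (a \<otimes> r) = (v \<otimes> r) \<otimes> (u \<otimes> (a \<otimes> t))"
      using cl uv(1,2) by (simp add: m_ac)
    also have "\<dots> = (u \<otimes> s) \<otimes> (v \<otimes> (b \<otimes> r))"
      using cl uv(1,2) by (simp add: uv(3) m_ac)
    also have "\<dots> = (u \<otimes> v \<otimes> t) \<otimes> (c \<otimes> s)"
      using cl uv(1,2) by (simp add: uv(4) m_ac)
    finally show "((a, s), (c, r)) \<in> loc_rel R S"
      using cl uv(1,2) by (auto simp: loc_rel_iff intro!: bexI[of _ "u \<otimes> v \<otimes> t"])
  qed
qed

lemma loc_frac_eq_iff:
  assumes "a \<in> carrier R" "s \<in> S" "b \<in> carrier R" "t \<in> S"
  shows "loc_frac R S a s = loc_frac R S b t \<longleftrightarrow> (\<exists>u\<in>S. u \<otimes> (a \<otimes> t) = u \<otimes> (b \<otimes> s))"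
  using assms eq_equiv_class_iff[OF equiv_loc_rel, of "(a, s)" "(b, t)"]
  by (simp add: loc_frac_def loc_rel_iff)

lemma loc_frac_closed [simp]:
  "a \<in> carrier R \<Longrightarrow> s \<in> S \<Longrightarrow> loc_frac R S a s \<in> carrier (localization R S)"
  by (auto simp: localization_def loc_frac_def intro: quotientI)

lemma localization_carrierE:
  assumes "x \<in> carrier (localization R S)"
  obtains a s where "a \<in> carrier R" "s \<in> S" "x = loc_frac R S a s"
  using assms by (auto simp: localization_def loc_frac_def elim!: quotientE)

lemma mem_loc_frac:
  assumes "a \<in> carrier R" "s \<in> S"
  shows "p \<in> loc_frac R S a s \<longleftrightarrow>
    (\<exists>b t. p = (b, t) \<and> b \<in> carrier R \<and> t \<in> S \<and> (\<exists>u\<in>S. u \<otimes> (a \<otimes> t) = u \<otimes> (b \<otimes> s)))"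
  using assms by (cases p) (auto simp: loc_frac_def loc_rel_iff)

lemma localization_mult:
  assumes "a \<in> carrier R" "s \<in> S" "b \<in> carrier R" "t \<in> S"
  shows "loc_frac R S a s \<otimes>\<^bsub>localization R S\<^esub> loc_frac R S b t = loc_frac R S (a \<otimes> b) (s \<otimes> t)"
proof -
  have "loc_frac R S (a' \<otimes> b') (s' \<otimes> t') = loc_frac R S (a \<otimes> b) (s \<otimes> t)"
    if "(a', s') \<in> loc_frac R S a s" "(b', t') \<in> loc_frac R S b t" for a' s' b' t'
  proof -
    from that assms obtain u v where uv: "u \<in> S" "v \<in> S"
      "u \<otimes> (a \<otimes> s') = u \<otimes> (a' \<otimes> s)" "v \<otimes> (b \<otimes> t') = v \<otimes> (b' \<otimes> t)"
      and cl: "a' \<in> carrier R" "s' \<in> S" "b' \<in> carrier R" "t' \<in> S"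
      by (auto simp: mem_loc_frac)
    have "(u \<otimes> v) \<otimes> ((a' \<otimes> b') \<otimes> (s \<otimes> t)) = (u \<otimes> (a' \<otimes> s)) \<otimes> (v \<otimes> (b' \<otimes> t))"
      using cl uv(1,2) assms by (simp add: m_ac)
    also have "\<dots> = (u \<otimes> (a \<otimes> s')) \<otimes> (v \<otimes> (b \<otimes> t'))"
      by (simp only: uv)
    also have "\<dots> = (u \<otimes> v) \<otimes> ((a \<otimes> b) \<otimes> (s' \<otimes> t'))"
      using cl uv(1,2) assms by (simp add: m_ac)
    finally show ?thesis
      using cl uv(1,2) assms
      by (auto simp: loc_frac_eq_iff intro!: bexI[of _ "u \<otimes> v"])
  qed
  moreover have "(a, s) \<in> loc_frac R S a s" "(b, t) \<in> loc_frac R S b t"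
    using assms by (auto simp: mem_loc_frac)
  ultimately show ?thesis
    unfolding localization_def ring.simps monoid.simps by (rule UN_classes_eq)
qed

lemma localization_add:
  assumes "a \<in> carrier R" "s \<in> S" "b \<in> carrier R" "t \<in> S"
  shows "loc_frac R S a s \<oplus>\<^bsub>localization R S\<^esub> loc_frac R S b t =
    loc_frac R S (a \<otimes> t \<oplus> b \<otimes> s) (s \<otimes> t)"
proof -
  have "loc_frac R S (a' \<otimes> t' \<oplus> b' \<otimes> s') (s' \<otimes> t') = loc_frac R S (a \<otimes> t \<oplus> b \<otimes> s) (s \<otimes> t)"
    if "(a', s') \<in> loc_frac R S a s" "(b', t') \<in> loc_frac R S b t" for a' s' b' t'
  proof -
    from that assms obtain u v where uv: "u \<in> S" "v \<in> S"
      "u \<otimes> (a \<otimes> s') = u \<otimes> (a' \<otimes> s)" "v \<otimes> (b \<otimes> t') = v \<otimes> (b' \<otimes> t)"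
      and cl: "a' \<in> carrier R" "s' \<in> S" "b' \<in> carrier R" "t' \<in> S"
      by (auto simp: mem_loc_frac)
    have "(u \<otimes> v) \<otimes> ((a' \<otimes> t' \<oplus> b' \<otimes> s') \<otimes> (s \<otimes> t)) =
        (u \<otimes> (a' \<otimes> s)) \<otimes> (v \<otimes> t \<otimes> t') \<oplus> (v \<otimes> (b' \<otimes> t)) \<otimes> (u \<otimes> s \<otimes> s')"
      using cl uv(1,2) assms by (simp add: m_ac l_distr r_distr)
    also have "\<dots> = (u \<otimes> (a \<otimes> s')) \<otimes> (v \<otimes> t \<otimes> t') \<oplus> (v \<otimes> (b \<otimes> t')) \<otimes> (u \<otimes> s \<otimes> s')"
      by (simp only: uv)
    also have "\<dots> = (u \<otimes> v) \<otimes> ((a \<otimes> t \<oplus> b \<otimes> s) \<otimes> (s' \<otimes> t'))"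
      using cl uv(1,2) assms by (simp add: m_ac l_distr r_distr)
    finally show ?thesis
      using cl uv(1,2) assms
      by (auto simp: loc_frac_eq_iff intro!: bexI[of _ "u \<otimes> v"])
  qed
  moreover have "(a, s) \<in> loc_frac R S a s" "(b, t) \<in> loc_frac R S b t"
    using assms by (auto simp: mem_loc_frac)
  ultimately show ?thesis
    unfolding localization_def ring.simps monoid.simps by (rule UN_classes_eq)
qed

lemma localization_zero: "\<zero>\<^bsub>localization R S\<^esub> = loc_frac R S \<zero> \<one>"
  and localization_one: "\<one>\<^bsub>localization R S\<^esub> = loc_frac R S \<one> \<one>"
  by (simp_all add: localization_def)

lemma loc_frac_eqI:
  assumes "a \<in> carrier R" "s \<in> S" "b \<in> carrier R" "t \<in> S" "a \<otimes> t = b \<otimes> s"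
  shows "loc_frac R S a s = loc_frac R S b t"
  using assms by (auto simp: loc_frac_eq_iff intro!: bexI[of _ \<one>])

lemma cring_localization: "cring (localization R S)"
proof -
  note ops = localization_mult localization_add localization_zero localization_one
  note distr = l_distr r_distr
  define L where "L = localization R S"
  have ex: "\<exists>a\<in>carrier R. \<exists>s\<in>S. x = loc_frac R S a s" if "x \<in> carrier L" for x
    using that unfolding L_def by (rule localization_carrierE) blast
  have one: "\<one>\<^bsub>L\<^esub> \<in> carrier L" "\<zero>\<^bsub>L\<^esub> \<in> carrier L"
    by (simp_all add: L_def ops)
  have inv: "\<exists>y\<in>carrier L. y \<oplus>\<^bsub>L\<^esub> x = \<zero>\<^bsub>L\<^esub>" and unit: "\<one>\<^bsub>L\<^esub> \<otimes>\<^bsub>L\<^esub> x = x" "\<zero>\<^bsub>L\<^esub> \<oplus>\<^bsub>L\<^esub> x = x"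
    if "x \<in> carrier L" for x
  proof -
    obtain a s where x: "x = loc_frac R S a s" and cl: "a \<in> carrier R" "s \<in> S"
      using ex[OF \<open>x \<in> carrier L\<close>] by blast
    have "loc_frac R S (\<ominus> a) s \<oplus>\<^bsub>L\<^esub> x = loc_frac R S \<zero> (s \<otimes> s)"
      using cl by (simp add: x L_def ops l_minus l_neg)
    also have "\<dots> = \<zero>\<^bsub>L\<^esub>"
      unfolding L_def localization_zero using cl by (intro loc_frac_eqI) auto
    finally show "\<exists>y\<in>carrier L. y \<oplus>\<^bsub>L\<^esub> x = \<zero>\<^bsub>L\<^esub>"
      using cl by (intro bexI[of _ "loc_frac R S (\<ominus> a) s"]) (auto simp: L_def)
    show "\<one>\<^bsub>L\<^esub> \<otimes>\<^bsub>L\<^esub> x = x" "\<zero>\<^bsub>L\<^esub> \<oplus>\<^bsub>L\<^esub> x = x"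
      using cl by (simp_all add: x L_def ops)
  qed
  have closed: "x \<oplus>\<^bsub>L\<^esub> y \<in> carrier L" "x \<otimes>\<^bsub>L\<^esub> y \<in> carrier L"
    and comm: "x \<oplus>\<^bsub>L\<^esub> y = y \<oplus>\<^bsub>L\<^esub> x" "x \<otimes>\<^bsub>L\<^esub> y = y \<otimes>\<^bsub>L\<^esub> x"
    if "x \<in> carrier L" "y \<in> carrier L" for x y
  proof -
    obtain a s b t where xy: "x = loc_frac R S a s" "y = loc_frac R S b t"
      and cl: "a \<in> carrier R" "s \<in> S" "b \<in> carrier R" "t \<in> S"
      using ex[OF \<open>x \<in> carrier L\<close>] ex[OF \<open>y \<in> carrier L\<close>] by blast
    show "x \<oplus>\<^bsub>L\<^esub> y \<in> carrier L" "x \<otimes>\<^bsub>L\<^esub> y \<in> carrier L"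
      using cl by (simp_all add: xy L_def ops)
    have "a \<otimes> t \<oplus> b \<otimes> s = b \<otimes> s \<oplus> a \<otimes> t"
      using cl by (intro a_comm) auto
    moreover have "a \<otimes> b = b \<otimes> a" "s \<otimes> t = t \<otimes> s"
      using cl by (simp_all add: m_comm)
    moreover have "x \<oplus>\<^bsub>L\<^esub> y = loc_frac R S (a \<otimes> t \<oplus> b \<otimes> s) (s \<otimes> t)"
      "x \<otimes>\<^bsub>L\<^esub> y = loc_frac R S (a \<otimes> b) (s \<otimes> t)"
      "y \<oplus>\<^bsub>L\<^esub> x = loc_frac R S (b \<otimes> s \<oplus> a \<otimes> t) (t \<otimes> s)"
      "y \<otimes>\<^bsub>L\<^esub> x = loc_frac R S (b \<otimes> a) (t \<otimes> s)"
      using cl by (simp_all add: xy L_def ops)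
    ultimately show "x \<oplus>\<^bsub>L\<^esub> y = y \<oplus>\<^bsub>L\<^esub> x" "x \<otimes>\<^bsub>L\<^esub> y = y \<otimes>\<^bsub>L\<^esub> x"
      by metis+
  qed
  have assoc: "x \<otimes>\<^bsub>L\<^esub> y \<otimes>\<^bsub>L\<^esub> z = x \<otimes>\<^bsub>L\<^esub> (y \<otimes>\<^bsub>L\<^esub> z)" "x \<oplus>\<^bsub>L\<^esub> y \<oplus>\<^bsub>L\<^esub> z = x \<oplus>\<^bsub>L\<^esub> (y \<oplus>\<^bsub>L\<^esub> z)"
    and dist: "(x \<oplus>\<^bsub>L\<^esub> y) \<otimes>\<^bsub>L\<^esub> z = x \<otimes>\<^bsub>L\<^esub> z \<oplus>\<^bsub>L\<^esub> y \<otimes>\<^bsub>L\<^esub> z"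
    if "x \<in> carrier L" "y \<in> carrier L" "z \<in> carrier L" for x y z
  proof -
    obtain a s b t c r
      where xyz: "x = loc_frac R S a s" "y = loc_frac R S b t" "z = loc_frac R S c r"
        and cl: "a \<in> carrier R" "s \<in> S" "b \<in> carrier R" "t \<in> S" "c \<in> carrier R" "r \<in> S"
      using ex[OF \<open>x \<in> carrier L\<close>] ex[OF \<open>y \<in> carrier L\<close>] ex[OF \<open>z \<in> carrier L\<close>] by blast
    show "x \<otimes>\<^bsub>L\<^esub> y \<otimes>\<^bsub>L\<^esub> z = x \<otimes>\<^bsub>L\<^esub> (y \<otimes>\<^bsub>L\<^esub> z)"
      using cl by (simp add: xyz L_def ops m_assoc)
    have "(a \<otimes> t \<oplus> b \<otimes> s) \<otimes> r \<oplus> c \<otimes> (s \<otimes> t) = a \<otimes> (t \<otimes> r) \<oplus> (b \<otimes> r \<oplus> c \<otimes> t) \<otimes> s"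
      using cl by (simp add: distr m_ac a_assoc)
    then show "x \<oplus>\<^bsub>L\<^esub> y \<oplus>\<^bsub>L\<^esub> z = x \<oplus>\<^bsub>L\<^esub> (y \<oplus>\<^bsub>L\<^esub> z)"
      using cl by (simp add: xyz L_def ops m_assoc)
    have "((a \<otimes> t \<oplus> b \<otimes> s) \<otimes> c) \<otimes> ((s \<otimes> r) \<otimes> (t \<otimes> r)) =
        ((a \<otimes> c) \<otimes> (t \<otimes> r) \<oplus> (b \<otimes> c) \<otimes> (s \<otimes> r)) \<otimes> ((s \<otimes> t) \<otimes> r)"
      using cl by (simp add: distr m_ac)
    then have "loc_frac R S ((a \<otimes> t \<oplus> b \<otimes> s) \<otimes> c) ((s \<otimes> t) \<otimes> r) =
        loc_frac R S ((a \<otimes> c) \<otimes> (t \<otimes> r) \<oplus> (b \<otimes> c) \<otimes> (s \<otimes> r)) ((s \<otimes> r) \<otimes> (t \<otimes> r))"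
      using cl by (intro loc_frac_eqI) auto
    then show "(x \<oplus>\<^bsub>L\<^esub> y) \<otimes>\<^bsub>L\<^esub> z = x \<otimes>\<^bsub>L\<^esub> z \<oplus>\<^bsub>L\<^esub> y \<otimes>\<^bsub>L\<^esub> z"
      using cl by (simp add: xyz L_def ops)
  qed
  have "abelian_group L"
    by (rule abelian_groupI) (fact closed one assoc comm unit inv)+
  moreover have "comm_monoid L"
    by (rule comm_monoidI) (fact closed one assoc comm unit)+
  ultimately have "cring L"
    by (rule cringI) (fact dist)
  then show ?thesis
    by (simp only: L_def)
qed

end

lemma (in cring) mult_submonoid_compl_primeideal:
  assumes "primeideal m R"
  shows "mult_submonoid R (carrier R - m)"
proof -
  interpret m: primeideal m R by fact
  show ?thesis
    by unfold_locales (use m.I_prime m.I_notcarr m.one_imp_carrier in auto)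
qed

text \<open>Meaningful only for finitely generated ideals.\<close>

definition min_gens :: "('a, 'b) ring_scheme \<Rightarrow> 'a set \<Rightarrow> nat" where
  "min_gens R I = (LEAST n. \<exists>A\<subseteq>carrier R. finite A \<and> card A = n \<and> I = genideal R A)"

fun ideal_power :: "('a, 'b) ring_scheme \<Rightarrow> 'a set \<Rightarrow> nat \<Rightarrow> 'a set" where
  "ideal_power R I 0 = carrier R"
| "ideal_power R I (Suc n) = ideal_prod R I (ideal_power R I n)"

definition is_reduction :: "('a, 'b) ring_scheme \<Rightarrow> 'a set \<Rightarrow> 'a set \<Rightarrow> bool" where
  "is_reduction R J I \<longleftrightarrow> ideal I R \<and> ideal J R \<and> J \<subseteq> I \<and>
     (\<exists>r. ideal_power R I (r + 1) = ideal_prod R J (ideal_power R I r))"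

text \<open>Meaningful only if \<open>J\<close> is a reduction of \<open>I\<close>.\<close>

definition reduction_number :: "('a, 'b) ring_scheme \<Rightarrow> 'a set \<Rightarrow> 'a set \<Rightarrow> nat" where
  "reduction_number R J I =
     (LEAST r. ideal_power R I (r + 1) = ideal_prod R J (ideal_power R I r))"

end

theory Submission
  imports Defs
begin

text \<open>
  Write \<open>F\<close>, \<open>M\<close>, \<open>C\<close> for the contents of \<open>f\<close>, \<open>g\<close>, \<open>f g\<close>. The essential point is the
  Dedekind--Mertens inclusion \<open>F^k M \<subseteq> F^(k-1) C\<close>; multiplying it by \<open>M^(k-1)\<close> gives the
  reduction. The inclusion may be checked up to a multiplier outside a given maximal ideal \<open>m\<close>.
  Let \<open>D\<close> be the set of those indices \<open>d\<close> for which the coefficient \<open>g_d\<close> does not lie in the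
  ideal generated by \<open>m M\<close> and the earlier coefficients. These \<open>g_d\<close> form a basis of \<open>M / m M\<close>, so
  \<open>p = |D|\<close> is at most \<open>k\<close>. By Nakayama it suffices that every product of \<open>p\<close> coefficients of
  \<open>f\<close> with some \<open>g_d\<close> lies in \<open>F^(p-1) C + m F^p M\<close>. The coefficients of \<open>f g\<close> provide relations
  that rewrite such a product into others; indexing the \<open>p\<close> factors from \<open>f\<close> by \<open>D\<close>, one finds a
  quadratic potential along which this rewriting terminates.
\<close>

section \<open>Ideals as submodules, their products and powers\<close>

text \<open>
  The name is qualified because HOL-Algebra has a locale \<open>module\<close> of its own. Ideals of the type
  \<open>'a\<close> are handled as submodules of \<open>'a\<close> over itself.
\<close>

interpretation idl: Modules.module "(*) :: 'a::comm_ring_1 \<Rightarrow> 'a \<Rightarrow> 'a"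
  by unfold_locales (simp_all add: algebra_simps)

declare idl.scale_scale [simp del] \<comment> \<open>loops with \<open>mult.assoc\<close>\<close>

abbreviation ring_of :: "'a::comm_ring_1 ring" (\<open>\<R>\<close>)
  where "\<R> \<equiv> ring_of_type_algebra"

lemma ring_of_type_algebra_simps [simp]:
  "carrier \<R> = UNIV" "x \<otimes>\<^bsub>\<R>\<^esub> y = x * y" "x \<oplus>\<^bsub>\<R>\<^esub> y = x + y" "\<zero>\<^bsub>\<R>\<^esub> = 0" "\<one>\<^bsub>\<R>\<^esub> = 1"
  by (simp_all add: ring_of_type_algebra_def)

lemma a_inv_ring_of [simp]: "\<ominus>\<^bsub>\<R>\<^esub> (x::'a::comm_ring_1) = - x"
proof -
  interpret cring "\<R> :: 'a ring" by (rule cring_from_type_algebra)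
  show ?thesis
    using minus_equality[of "- x" x] by simp
qed

lemma ideal_ring_of_iff: "ideal I \<R> \<longleftrightarrow> idl.subspace I" for I :: "'a::comm_ring_1 set"
proof -
  interpret cring "\<R> :: 'a ring" by (rule cring_from_type_algebra)
  show ?thesis
  proof
    assume "ideal I \<R>"
    then interpret I: ideal I "\<R> :: 'a ring" .
    show "idl.subspace I"
      using I.zero_closed I.a_closed I.I_l_closed by (auto intro!: idl.subspaceI)
  next
    assume I: "idl.subspace I"
    have "subgroup I (add_monoid \<R>)"
      using idl.subspace_0[OF I] idl.subspace_add[OF I] idl.subspace_neg[OF I]
      by (intro add.subgroupI) (auto simp flip: a_inv_def)
    then show "ideal I \<R>"
      using idl.subspace_scale[OF I]
      by (intro idealI ring_axioms) (auto simp: mult.commute)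
  qed
qed

lemma genideal_ring_of: "genideal \<R> S = idl.span S"
  by (auto simp: genideal_def ideal_ring_of_iff idl.span_def hull_def)

text \<open>Lets \<open>a * x \<in> Q\<close> be checked on generators:
  \<open>idl.span_minimal\<close> and \<open>ideal_prod_subsetI\<close> apply to this set.\<close>

lemma subspace_colon:
  assumes "idl.subspace Q"
  shows "idl.subspace {x. a * x \<in> Q}"
  using assms by (auto simp: idl.subspace_def algebra_simps)

lemma ideal_prod_subspace [intro, simp]:
  "idl.subspace I \<Longrightarrow> idl.subspace J \<Longrightarrow> idl.subspace (ideal_prod \<R> I J)"
  using ring.ideal_prod_is_ideal[OF ring_from_type_algebra, of I J]
  by (simp add: ideal_ring_of_iff)

lemma ideal_prodI: "x \<in> I \<Longrightarrow> y \<in> J \<Longrightarrow> x * y \<in> ideal_prod \<R> I J"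
  using ideal_prod.prod[of x I y J \<R>] by simp

lemma ideal_prod_subsetI:
  assumes "idl.subspace Q" "\<And>x y. x \<in> I \<Longrightarrow> y \<in> J \<Longrightarrow> x * y \<in> Q"
  shows "ideal_prod \<R> I J \<subseteq> Q"
proof
  fix z assume "z \<in> ideal_prod \<R> I J"
  then show "z \<in> Q"
    by induction (auto intro: assms idl.subspace_add)
qed

text \<open>Ideals form a commutative monoid under the product, so \<open>ideal_power_add\<close>
  and \<open>ideal_power_prod\<close> are inherited from the power laws there.\<close>

lemma ideal_power_eq_nat_pow:
  assumes "idl.subspace I"
  shows "ideal_power \<R> I n = I [^]\<^bsub>ideals_set \<R>\<^esub> n"
proof -
  interpret comm_monoid "ideals_set \<R> :: 'a set ring"
    by (rule cring.ideals_set_is_comm_monoid[OF cring_from_type_algebra])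
  have I: "I \<in> carrier (ideals_set \<R>)"
    using assms by (simp add: ideals_set_def ideal_ring_of_iff)
  show ?thesis
  proof (induction n)
    case 0
    then show ?case by (simp add: ideals_set_def nat_pow_def)
  next
    case (Suc n)
    then show ?case
      using nat_pow_Suc2[OF I, of n] by (simp add: ideals_set_def)
  qed
qed

lemma ideal_power_add:
  assumes "idl.subspace I"
  shows "ideal_power \<R> I (i + j) = ideal_prod \<R> (ideal_power \<R> I i) (ideal_power \<R> I j)"
proof -
  interpret comm_monoid "ideals_set \<R> :: 'a set ring"
    by (rule cring.ideals_set_is_comm_monoid[OF cring_from_type_algebra])
  have I: "I \<in> carrier (ideals_set \<R>)"
    using assms by (simp add: ideals_set_def ideal_ring_of_iff)
  show ?thesis
    using nat_pow_mult[OF I, of i j] assms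
    by (simp add: ideal_power_eq_nat_pow) (simp add: ideals_set_def)
qed

lemma ideal_power_prod:
  assumes "idl.subspace I" "idl.subspace J"
  shows "ideal_power \<R> (ideal_prod \<R> I J) n = ideal_prod \<R> (ideal_power \<R> I n) (ideal_power \<R> J n)"
proof -
  interpret comm_monoid "ideals_set \<R> :: 'a set ring"
    by (rule cring.ideals_set_is_comm_monoid[OF cring_from_type_algebra])
  have "I \<in> carrier (ideals_set \<R>)" "J \<in> carrier (ideals_set \<R>)"
    using assms by (simp_all add: ideals_set_def ideal_ring_of_iff)
  from nat_pow_distrib[OF this, of n] show ?thesis
    using assms by (simp add: ideal_power_eq_nat_pow) (simp add: ideals_set_def)
qed

lemma ideal_power_subspace [intro, simp]:
  "idl.subspace I \<Longrightarrow> idl.subspace (ideal_power \<R> I n)"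
  by (induction n) auto

lemma prod_mem_ideal_power:
  "finite D \<Longrightarrow> (\<And>d. d \<in> D \<Longrightarrow> u d \<in> I) \<Longrightarrow> prod u D \<in> ideal_power \<R> I (card D)"
  by (induction D rule: finite_induct) (auto intro: ideal_prodI)

text \<open>A power of a span is spanned by products of generators, peeled off here one factor at a
  time. The exponent is written \<open>card D\<close> so that the factors are indexed by
  \<open>D\<close>, as in \<open>products_mem\<close>.\<close>

lemma ideal_power_mult_mem:
  assumes "finite D" "idl.subspace Q" "x \<in> ideal_power \<R> (idl.span (range f)) (card D)"
    and "\<And>b. (\<Prod>d\<in>D. f (b d)) * y \<in> Q"
  shows "x * y \<in> Q"
  using assms(1,3,4)
proof (induction D arbitrary: x y rule: finite_induct)
  case empty
  then show ?case using assms(2) by (auto intro: idl.subspace_scale)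
next
  case (insert d D)
  \<comment> \<open>The factor \<open>f n\<close> belonging to \<open>d\<close> is absorbed into
    \<open>y\<close>, which is why the induction generalizes \<open>y\<close>.\<close>
  have f: "v * (f n * y) \<in> Q" if "v \<in> ideal_power \<R> (idl.span (range f)) (card D)" for v n
  proof (rule insert.IH[OF that])
    fix b
    have "(\<Prod>i\<in>insert d D. f ((b(d := n)) i)) = f n * (\<Prod>i\<in>D. f (b i))"
      using insert.hyps by (auto intro!: arg_cong[of _ _ "(*) (f n)"] prod.cong)
    then show "(\<Prod>d\<in>D. f (b d)) * (f n * y) \<in> Q"
      using insert.prems(2)[of "b(d := n)"] by (simp add: ac_simps)
  qed
  have "u * v * y \<in> Q"
    if "u \<in> idl.span (range f)" "v \<in> ideal_power \<R> (idl.span (range f)) (card D)" for u v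
    using that(1)
  proof (induction rule: idl.span_induct)
    case base
    show ?case
      using subspace_colon[OF assms(2), of "v * y"] by (simp add: ac_simps)
  next
    case (step x)
    then show ?case using f[OF that(2)] by (auto simp: ac_simps)
  qed
  moreover have "idl.subspace {x. x * y \<in> Q}"
    using subspace_colon[OF assms(2), of y] by (simp add: mult.commute)
  ultimately have "ideal_prod \<R> (idl.span (range f)) (ideal_power \<R> (idl.span (range f)) (card D))
      \<subseteq> {x. x * y \<in> Q}"
    by (intro ideal_prod_subsetI) auto
  then show ?case
    using insert by auto
qed

section \<open>Maximal ideals and Nakayama's lemma\<close>

lemma maximalideal_ring_ofD:
  assumes "maximalideal m \<R>"
  shows "idl.subspace m" "1 \<notin> m" "a \<notin> m \<Longrightarrow> \<exists>b. 1 - b * a \<in> m"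
    "a \<notin> m \<Longrightarrow> b \<notin> m \<Longrightarrow> a * b \<notin> m"
proof -
  interpret maximalideal m "\<R> :: 'a ring" by fact
  show m: "idl.subspace m"
    using is_ideal by (simp add: ideal_ring_of_iff)
  show "1 \<notin> m"
    using one_imp_carrier I_notcarr by auto
  show "\<exists>b. 1 - b * a \<in> m" if "a \<notin> m"
  proof -
    have "idl.span (insert a m) = UNIV"
      using I_maximal[of "idl.span (insert a m)"] idl.span_superset[of "insert a m"] that
      by (auto simp: ideal_ring_of_iff)
    then have "1 \<in> idl.span (insert a m)" by simp
    then show ?thesis
      using m by (auto simp: idl.span_insert idl.span_eq_iff[THEN iffD2])
  qed
  interpret primeideal m "\<R> :: 'a ring"
    by (rule cring.maximalideal_prime[OF cring_from_type_algebra]) fact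
  show "a * b \<notin> m" if "a \<notin> m" "b \<notin> m"
    using that I_prime[of a b] by auto
qed

lemma noetherian_finite_span:
  fixes I :: "'a::comm_ring_1 set"
  assumes "noetherian_ring (\<R> :: 'a ring)" "idl.subspace I"
  obtains B where "finite B" "I = idl.span B"
  using noetherian_ring.finetely_gen[OF assms(1), of I] assms(2)
  by (auto simp: ideal_ring_of_iff genideal_ring_of)

text \<open>Zorn's lemma: a nonempty chain of ideals of a Noetherian ring contains its own union,
  which therefore still omits 1.\<close>

lemma noetherian_maximalideal:
  fixes I :: "'a::comm_ring_1 set"
  assumes "noetherian_ring (\<R> :: 'a ring)" "idl.subspace I" "1 \<notin> I"
  obtains m where "maximalideal m \<R>" "I \<subseteq> m"
proof -
  define P where "P = {J. ideal J \<R> \<and> I \<subseteq> J \<and> 1 \<notin> J}"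
  have "\<exists>M\<in>P. \<forall>B\<in>P. M \<subseteq> B \<longrightarrow> B = M"
  proof (rule subset_Zorn_nonempty)
    show "P \<noteq> {}"
      using assms(2,3) by (auto simp: P_def ideal_ring_of_iff)
    show "\<Union>C \<in> P" if "C \<noteq> {}" "subset.chain P C" for C
    proof -
      have "subset.chain {J. ideal J \<R>} C"
        using that(2) by (auto simp: subset_chain_def P_def)
      with noetherian_ring.ideal_chain_is_trivial[OF assms(1) that(1)] have "\<Union>C \<in> C"
        by blast
      then show ?thesis
        using that(2) by (auto simp: subset_chain_def)
    qed
  qed
  then obtain m where m: "m \<in> P" "\<And>B. B \<in> P \<Longrightarrow> m \<subseteq> B \<Longrightarrow> B = m"
    by blast
  have "maximalideal m \<R>"
  proof (rule maximalidealI)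
    show "J = m \<or> J = carrier \<R>" if J: "ideal J \<R>" "m \<subseteq> J" for J
    proof (cases "1 \<in> J")
      case True
      then show ?thesis using ideal.one_imp_carrier[OF J(1)] by simp
    next
      case False
      then show ?thesis using m J by (auto simp: P_def)
    qed
  qed (use m in \<open>auto simp: P_def\<close>)
  then show ?thesis
    using that m by (auto simp: P_def)
qed

text \<open>The multipliers \<open>s\<close> with \<open>s * x \<in> Q\<close> form an ideal. If it
  were proper, a maximal ideal containing it would contradict the local hypothesis.\<close>

lemma mem_if_locally_mem:
  fixes Q :: "'a::comm_ring_1 set"
  assumes "noetherian_ring (\<R> :: 'a ring)" "idl.subspace Q"
    and "\<And>m. maximalideal m \<R> \<Longrightarrow> \<exists>s. s \<notin> m \<and> s * x \<in> Q"
  shows "x \<in> Q"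
proof (rule ccontr)
  assume "x \<notin> Q"
  have "idl.subspace {s. s * x \<in> Q}"
    using subspace_colon[OF assms(2), of x] by (simp add: mult.commute)
  then obtain m where "maximalideal m \<R>" "{s. s * x \<in> Q} \<subseteq> m"
    using noetherian_maximalideal[OF assms(1), of "{s. s * x \<in> Q}"] \<open>x \<notin> Q\<close> by auto
  then show False
    using assms(3)[of m] by auto
qed

text \<open>A version without fractions: modulo \<open>Q\<close>, the span of \<open>B\<close>
  equals \<open>m\<close> times itself, so it vanishes locally at \<open>m\<close>. The generators
  are eliminated one at a time, and the multipliers used are collected in \<open>s\<close>.\<close>

lemma Nakayama:
  assumes m: "maximalideal m \<R>" and Q: "idl.subspace Q" and B: "finite B"
    and sub: "B \<subseteq> idl.span (Q \<union> ideal_prod \<R> m (idl.span B))"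
  obtains s where "s \<notin> m" "\<And>x. x \<in> idl.span B \<Longrightarrow> s * x \<in> Q"
proof -
  note mx = maximalideal_ring_ofD[OF m]
  \<comment> \<open>\<open>Y\<close> is the set of generators already eliminated; for
    \<open>Y = B\<close> only \<open>Q\<close> remains.\<close>
  have ex: "\<exists>s. s \<notin> m \<and> (\<forall>x\<in>B. s * x \<in> idl.span (Q \<union> (B - Y)))" if "Y \<subseteq> B" for Y
    using finite_subset[OF that B] that
  proof (induction Y rule: finite_induct)
    case empty
    then show ?case
      using mx(2) by (intro exI[of _ 1]) (auto intro: idl.span_base)
  next
    case (insert y Y)
    then obtain s where s: "s \<notin> m" "\<And>x. x \<in> B \<Longrightarrow> s * x \<in> idl.span (Q \<union> (B - Y))"
      by auto
    define W where "W = idl.span (Q \<union> (B - insert y Y))"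
    have W: "idl.subspace W" by (simp add: W_def)
    have "insert y (Q \<union> (B - insert y Y)) \<supseteq> Q \<union> (B - Y)"
      by auto
    then have "idl.span (Q \<union> (B - Y)) \<subseteq> {t. \<exists>c. t - c * y \<in> W}"
      unfolding W_def by (subst idl.span_insert[symmetric]) (rule idl.span_mono)
    with s(2) have sX: "\<exists>c. s * x - c * y \<in> W" if "x \<in> B" for x
      using that by blast
    have sspan: "\<exists>c. s * x - c * y \<in> W" if "x \<in> idl.span B" for x
      using that
    proof (induction rule: idl.span_induct_alt)
      case base
      show ?case using idl.subspace_0[OF W] by (auto intro: exI[of _ 0])
    next
      case (step c x z)
      obtain p q where "s * x - p * y \<in> W" "s * z - q * y \<in> W"
        using sX step by blast
      then have "c * (s * x - p * y) + (s * z - q * y) \<in> W"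
        using W by (intro idl.subspace_add idl.subspace_scale)
      then show ?case
        by (intro exI[of _ "c * p + q"]) (simp add: algebra_simps)
    qed
    \<comment> \<open>Modulo \<open>W\<close>, \<open>s\<close> sends the elements of
      \<open>T\<close> to multiples of \<open>y\<close> by elements of \<open>m\<close>. Once
      \<open>T\<close> contains \<open>Q\<close> and \<open>m\<close> times the span of
      \<open>B\<close>, it contains \<open>y\<close> itself.\<close>
    define T where "T = {t. \<exists>c\<in>m. s * t - c * y \<in> W}"
    have T: "idl.subspace T"
    proof (rule idl.subspaceI)
      show "0 \<in> T"
        using idl.subspace_0[OF W] idl.subspace_0[OF mx(1)] by (auto simp: T_def intro!: bexI[of _ 0])
      show "x + z \<in> T" if "x \<in> T" "z \<in> T" for x z
      proof -
        obtain p q where "p \<in> m" "q \<in> m" "s * x - p * y \<in> W" "s * z - q * y \<in> W"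
          using \<open>x \<in> T\<close> \<open>z \<in> T\<close> by (auto simp: T_def)
        with W have "(s * x - p * y) + (s * z - q * y) \<in> W" "p + q \<in> m"
          using mx(1) by (auto intro: idl.subspace_add)
        then show ?thesis
          by (auto simp: T_def algebra_simps intro!: bexI[of _ "p + q"])
      qed
      show "c * x \<in> T" if "x \<in> T" for c x
      proof -
        obtain p where "p \<in> m" "s * x - p * y \<in> W"
          using \<open>x \<in> T\<close> by (auto simp: T_def)
        with W have "c * (s * x - p * y) \<in> W" "c * p \<in> m"
          using mx(1) by (auto intro: idl.subspace_scale)
        then show ?thesis
          by (auto simp: T_def algebra_simps intro!: bexI[of _ "c * p"])
      qed
    qed
    have "Q \<subseteq> T"
    proof
      fix q assume "q \<in> Q"
      then have "q \<in> W"
        unfolding W_def by (simp add: idl.span_base)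
      then have "s * q - 0 * y \<in> W"
        using W by (simp add: idl.subspace_scale)
      then show "q \<in> T"
        using idl.subspace_0[OF mx(1)] by (force simp: T_def)
    qed
    moreover have "ideal_prod \<R> m (idl.span B) \<subseteq> T"
    proof (rule ideal_prod_subsetI[OF T])
      fix a x assume "a \<in> m" "x \<in> idl.span B"
      then obtain c where "s * x - c * y \<in> W"
        using sspan by blast
      then have "a * (s * x - c * y) \<in> W"
        using W by (intro idl.subspace_scale)
      moreover have "c * a \<in> m"
        using \<open>a \<in> m\<close> mx(1) by (intro idl.subspace_scale)
      ultimately show "a * x \<in> T"
        by (auto simp: T_def algebra_simps intro!: bexI[of _ "c * a"])
    qed
    ultimately have "B \<subseteq> T"
      using sub idl.span_minimal[OF _ T, of "Q \<union> ideal_prod \<R> m (idl.span B)"] by blast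
    then obtain c where c: "c \<in> m" "s * y - c * y \<in> W"
      using insert.prems by (auto simp: T_def)
    have "s - c \<notin> m"
      using s(1) c(1) idl.subspace_add[OF mx(1), of "s - c" c] by auto
    \<comment> \<open>Modulo \<open>W\<close>, \<open>s * x\<close> is a multiple of
      \<open>y\<close> and \<open>s - c\<close> annihilates \<open>y\<close>, so the product of the
      two is the new multiplier.\<close>
    then have "(s - c) * s \<notin> m"
      using mx(4) s(1) by blast
    moreover have "(s - c) * s * x \<in> W" if "x \<in> B" for x
    proof -
      obtain p where "s * x - p * y \<in> W"
        using sX \<open>x \<in> B\<close> by blast
      with c(2) have "(s - c) * (s * x - p * y) + p * (s * y - c * y) \<in> W"
        using W by (intro idl.subspace_add idl.subspace_scale)
      then show ?thesis
        by (simp add: algebra_simps)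
    qed
    ultimately show ?case
      unfolding W_def by blast
  qed
  obtain s where s: "s \<notin> m" "\<And>x. x \<in> B \<Longrightarrow> s * x \<in> Q"
    using ex[of B] Q by (auto simp: idl.span_eq_iff[THEN iffD2])
  have "idl.span B \<subseteq> {x. s * x \<in> Q}"
    using s(2) by (intro idl.span_minimal subspace_colon[OF Q]) auto
  then show ?thesis
    using that[OF s(1)] by blast
qed

section \<open>The Dedekind--Mertens formula at a maximal ideal\<close>

text \<open>Gaussian elimination over the residue field of \<open>m\<close>, done with
  representatives in the ring. A coefficient outside \<open>m\<close> serves as pivot, and its
  unknown and equation are dropped.\<close>

lemma homogeneous_system_mod_maximalideal:
  fixes c :: "'i \<Rightarrow> 'j \<Rightarrow> 'a::comm_ring_1"
  assumes m: "maximalideal m \<R>" and "finite E" "finite D" "card E < card D"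
  shows "\<exists>x. (\<exists>d\<in>D. x d \<notin> m) \<and> (\<forall>e\<in>E. (\<Sum>d\<in>D. x d * c d e) \<in> m)"
  using assms(2-)
proof (induction E arbitrary: D c rule: finite_induct)
  case empty
  then obtain d where "d \<in> D" by (auto simp: card_gt_0_iff)
  then show ?case
    using maximalideal_ring_ofD(2)[OF m] by (intro exI[of _ "\<lambda>_. 1"]) auto
next
  case (insert e E)
  note mx = maximalideal_ring_ofD[OF m]
  show ?case
  proof (cases "\<forall>d\<in>D. c d e \<in> m")
    case True
    obtain x where "\<exists>d\<in>D. x d \<notin> m" "\<forall>e\<in>E. (\<Sum>d\<in>D. x d * c d e) \<in> m"
      using insert.IH[of D c] insert.prems insert.hyps by auto
    moreover have "(\<Sum>d\<in>D. x d * c d e) \<in> m"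
      using True mx(1) by (intro idl.subspace_sum idl.subspace_scale) auto
    ultimately show ?thesis by auto
  next
    case False
    then obtain d0 where d0: "d0 \<in> D" "c d0 e \<notin> m" by blast
    define D' where "D' = D - {d0}"
    have D': "finite D'" "card E < card D'" "d0 \<notin> D'" "D = insert d0 D'"
      using insert.prems insert.hyps d0(1) by (auto simp: D'_def)
    \<comment> \<open>Cross-multiplication with the pivot \<open>c d0 e\<close> replaces division by
      it. Accordingly \<open>x'\<close> is scaled by the pivot, and its value at \<open>d0\<close>
      is chosen to solve equation \<open>e\<close> exactly.\<close>
    define c' where "c' = (\<lambda>d i. c d0 e * c d i - c d e * c d0 i)"
    obtain x where x: "\<exists>d\<in>D'. x d \<notin> m" "\<forall>i\<in>E. (\<Sum>d\<in>D'. x d * c' d i) \<in> m"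
      using insert.IH[OF D'(1,2), of c'] by auto
    define x' where "x' = (\<lambda>d. if d = d0 then - (\<Sum>d\<in>D'. x d * c d e) else x d * c d0 e)"
    have sum: "(\<Sum>d\<in>D. x' d * c d i) = (\<Sum>d\<in>D'. x d * c' d i)" for i
    proof -
      have "(\<Sum>d\<in>D'. x' d * c d i) = (\<Sum>d\<in>D'. x d * c d0 e * c d i)"
        using D'(3) by (intro sum.cong) (auto simp: x'_def)
      moreover have "x' d0 * c d0 i = - (\<Sum>d\<in>D'. x d * c d e * c d0 i)"
        by (simp add: x'_def sum_distrib_right)
      ultimately show ?thesis
        using D' by (simp add: c'_def algebra_simps sum_subtractf)
    qed
    have "c' d e = 0" for d
      by (simp add: c'_def algebra_simps)
    then have "(\<Sum>d\<in>D. x' d * c d e) \<in> m"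
      using idl.subspace_0[OF mx(1)] by (simp add: sum)
    moreover have "\<exists>d\<in>D. x' d \<notin> m"
    proof -
      obtain d where "d \<in> D'" "x d \<notin> m" using x(1) by blast
      then show ?thesis
        using D'(3,4) mx(4)[OF _ d0(2), of "x d"] by (intro bexI[of _ d]) (auto simp: x'_def)
    qed
    ultimately show ?thesis
      using x(2) by (intro exI[of _ x']) (auto simp: sum)
  qed
qed

section \<open>Jumps and their number\<close>

text \<open>
  For \<open>N = m M\<close>, where \<open>M\<close> is generated by the values of \<open>g\<close>, the values of \<open>g\<close> at the jumps form a
  basis of the vector space \<open>M / m M\<close> over the residue field of \<open>m\<close>.
\<close>

definition jumps :: "'a set \<Rightarrow> (nat \<Rightarrow> 'a::comm_ring_1) \<Rightarrow> nat set" where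
  "jumps N g = {d. g d \<notin> idl.span (g ` {..<d} \<union> N)}"

lemma mem_span_jumps: "g i \<in> idl.span (g ` {d \<in> jumps N g. d \<le> i} \<union> N)"
proof (induction i rule: less_induct)
  case (less i)
  show ?case
  proof (cases "i \<in> jumps N g")
    case True
    then show ?thesis by (auto intro: idl.span_base)
  next
    case False
    have "g ` {..<i} \<union> N \<subseteq> idl.span (g ` {d \<in> jumps N g. d \<le> i} \<union> N)"
    proof -
      have "g j \<in> idl.span (g ` {d \<in> jumps N g. d \<le> i} \<union> N)" if "j < i" for j
      proof -
        have "g ` {d \<in> jumps N g. d \<le> j} \<union> N \<subseteq> g ` {d \<in> jumps N g. d \<le> i} \<union> N"
          using that by auto
        then show ?thesis
          using less[OF that] idl.span_mono by blast
      qed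
      then show ?thesis by (auto intro: idl.span_base)
    qed
    then have "idl.span (g ` {..<i} \<union> N) \<subseteq> idl.span (g ` {d \<in> jumps N g. d \<le> i} \<union> N)"
      by (rule idl.span_minimal) simp
    then show ?thesis
      using False by (auto simp: jumps_def)
  qed
qed

text \<open>The strict bound \<open>d < i\<close> becomes the drop of weight in
  \<open>products_mem\<close>.\<close>

lemma mem_span_less_jumps:
  assumes "i \<notin> jumps N g"
  shows "g i \<in> idl.span (g ` {d \<in> jumps N g. d < i} \<union> N)"
proof -
  have "{d \<in> jumps N g. d \<le> i} = {d \<in> jumps N g. d < i}"
    using assms by (auto simp: order_le_less)
  then show ?thesis
    using mem_span_jumps[of g i N] by simp
qed

text \<open>Modulo \<open>m M\<close> the values at the jumps are linearly independent over the
  residue field, while up to multipliers outside \<open>m\<close> they are combinations of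
  \<open>E\<close>.\<close>

lemma card_jumps_le:
  fixes g :: "nat \<Rightarrow> 'a::comm_ring_1"
  assumes m: "maximalideal m \<R>" and E: "finite E" "E \<subseteq> M" and g: "range g \<subseteq> M"
    and span: "\<And>i. \<exists>s. s \<notin> m \<and> s * g i \<in> idl.span E"
  shows "finite (jumps (ideal_prod \<R> m M) g) \<and> card (jumps (ideal_prod \<R> m M) g) \<le> card E"
proof -
  note mx = maximalideal_ring_ofD[OF m]
  define N where "N = ideal_prod \<R> m M"
  have *: "card D \<le> card E" if D: "finite D" "D \<subseteq> jumps N g" for D
  proof (rule ccontr)
    assume "\<not> card D \<le> card E"
    obtain s where s: "\<And>i. s i \<notin> m" "\<And>i. s i * g i \<in> idl.span E"
      using span by metis
    have "\<exists>c. s i * g i = (\<Sum>e\<in>E. c e * e)" for i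
      using s(2)[of i] by (auto simp: idl.span_finite[OF E(1)])
    then obtain c where c: "\<And>i. s i * g i = (\<Sum>e\<in>E. c i e * e)"
      by metis
    obtain x where x: "\<exists>d\<in>D. x d \<notin> m" "\<forall>e\<in>E. (\<Sum>d\<in>D. x d * c d e) \<in> m"
      using homogeneous_system_mod_maximalideal[OF m E(1) D(1), of c] \<open>\<not> card D \<le> card E\<close>
      by auto
    \<comment> \<open>\<open>d\<close> is the last index whose coefficient is nonzero modulo
      \<open>m\<close>. Later terms lie in \<open>m M\<close> and earlier ones in the span of
      previous values, so the relation puts \<open>g d\<close> into the span that a jump
      avoids.\<close>
    define D' where "D' = {d \<in> D. x d \<notin> m}"
    define d where "d = Max D'"
    have "finite D'" "D' \<noteq> {}"
      using D x(1) by (auto simp: D'_def)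
    then have d: "d \<in> D" "x d \<notin> m" and le: "\<And>i. i \<in> D \<Longrightarrow> i > d \<Longrightarrow> x i \<in> m"
      using Max_in[of D'] Max_ge[of D'] unfolding d_def[symmetric] by (force simp: D'_def)+
    define W where "W = idl.span (g ` {..<d} \<union> N)"
    have W: "idl.subspace W" by (simp add: W_def)
    have NW: "a * y \<in> W" if "a \<in> m" "y \<in> M" for a y
      using that ideal_prodI[of a m y M] by (auto simp: W_def N_def intro: idl.span_base)
    have "(\<Sum>i\<in>D. x i * (s i * g i)) = (\<Sum>i\<in>D. \<Sum>e\<in>E. x i * c i e * e)"
      by (simp add: c sum_distrib_left mult.assoc)
    also have "\<dots> = (\<Sum>e\<in>E. (\<Sum>i\<in>D. x i * c i e) * e)"
      by (subst sum.swap) (simp add: sum_distrib_right)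
    also have "\<dots> \<in> W"
      using x(2) E by (intro idl.subspace_sum[OF W] NW) auto
    finally have "(\<Sum>i\<in>D. x i * (s i * g i)) \<in> W" .
    moreover have "(\<Sum>i\<in>D - {d}. x i * (s i * g i)) \<in> W"
    proof (rule idl.subspace_sum[OF W])
      fix i assume i: "i \<in> D - {d}"
      show "x i * (s i * g i) \<in> W"
      proof (cases "i < d")
        case True
        then have "g i \<in> W" by (auto simp: W_def intro: idl.span_base)
        then show ?thesis by (intro idl.subspace_scale[OF W])
      next
        case False
        then have "s i * x i \<in> m"
          using le i by (intro idl.subspace_scale[OF mx(1)]) auto
        then show ?thesis
          using NW[of "s i * x i" "g i"] g by (auto simp: ac_simps)
      qed
    qed
    ultimately have xsg: "x d * s d * g d \<in> W"
      using idl.subspace_diff[OF W] by (simp add: sum.remove[OF D(1) d(1)] mult.assoc) fastforce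
    \<comment> \<open>\<open>b\<close> inverts \<open>x d * s d\<close> modulo \<open>m\<close>; the
      defect \<open>1 - b * (x d * s d)\<close> carries \<open>g d\<close> into
      \<open>m M\<close>.\<close>
    obtain b where "1 - b * (x d * s d) \<in> m"
      using mx(3) mx(4)[OF d(2) s(1)] by blast
    then have "(1 - b * (x d * s d)) * g d + b * (x d * s d * g d) \<in> W"
      using g by (intro idl.subspace_add[OF W] NW idl.subspace_scale[OF W] xsg) auto
    then have "g d \<in> W"
      by (simp add: algebra_simps)
    then show False
      using d(1) D(2) by (auto simp: jumps_def W_def)
  qed
  have "finite (jumps N g)"
    using * infinite_arbitrarily_large[of "jumps N g" "Suc (card E)"] by fastforce
  then show ?thesis
    using * by (auto simp: N_def)
qed

section \<open>Termination of the rewriting of products\<close>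

lemma products_mem:
  fixes f g :: "nat \<Rightarrow> 'a::comm_ring_1" and D :: "nat set"
  assumes D: "finite D" and Q: "idl.subspace Q"
    and coeff: "\<And>b d n. d \<in> D \<Longrightarrow> (\<Prod>i\<in>D - {d}. f (b i)) * (\<Sum>i\<le>n. f (n - i) * g i) \<in> Q"
    and span: "\<And>b i. i \<notin> D \<Longrightarrow> (\<And>d. d \<in> D \<Longrightarrow> d < i \<Longrightarrow> (\<Prod>d\<in>D. f (b d)) * g d \<in> Q) \<Longrightarrow>
      (\<Prod>d\<in>D. f (b d)) * g i \<in> Q"
    and d: "d \<in> D"
  shows "(\<Prod>i\<in>D. f (b i)) * g d \<in> Q"
proof -
  \<comment> \<open>The relation \<open>coeff\<close> with \<open>n = b d + d\<close> expresses the product for \<open>(b, d)\<close> through the products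
    for \<open>(b(d := n - i), i)\<close>. For \<open>i\<close> in \<open>D\<close> these have the same weight \<open>w\<close>, while \<open>e\<close>
    increases by \<open>(d - i)^2\<close>; for \<open>i\<close> outside \<open>D\<close> they reduce to products of smaller weight.\<close>
  define w where "w = (\<lambda>(b, d). (\<Sum>i\<in>D. b i) + d :: nat)"
  define m where "m = Max D"
  define e where "e = (\<lambda>(b, d). 2 * (\<Sum>i\<in>D. b i * i) + d ^ 2 :: nat)"
  \<comment> \<open>By \<open>le\<close> the subtraction does not truncate when \<open>d\<close> is
    in \<open>D\<close>, so an increase of \<open>e\<close> at constant \<open>w\<close> is a
    decrease of \<open>h\<close>. The induction is lexicographic in \<open>w\<close> and
    \<open>h\<close>.\<close>
  define h where "h = (\<lambda>p. 2 * w p * m + m ^ 2 - e p)"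
  have le: "e (b, d) \<le> 2 * w (b, d) * m + m ^ 2" if "d \<in> D" for b d
  proof -
    have m: "i \<le> m" if "i \<in> D" for i
      using that D by (simp add: m_def)
    have "(\<Sum>i\<in>D. b i * i) \<le> (\<Sum>i\<in>D. b i) * m"
      unfolding sum_distrib_right by (intro sum_mono mult_mono m) auto
    also have "\<dots> \<le> w (b, d) * m"
      by (simp add: w_def)
    finally have "2 * (\<Sum>i\<in>D. b i * i) \<le> 2 * w (b, d) * m"
      by simp
    moreover have "d ^ 2 \<le> m ^ 2"
      using m[OF that] by (rule power_mono) simp
    ultimately show ?thesis
      unfolding e_def case_prod_conv by (rule add_mono)
  qed
  have "snd p \<in> D \<longrightarrow> (\<Prod>i\<in>D. f (fst p i)) * g (snd p) \<in> Q" for p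
  proof (induction p rule: wf_induct[OF wf_measures[of "[w, h]"]])
    case (1 p)
    obtain b d where p: "p = (b, d)" by (cases p)
    have "(\<Prod>i\<in>D. f (b i)) * g d \<in> Q" if d: "d \<in> D"
    proof -
      define n where "n = b d + d"
      define u where "u = (\<Prod>i\<in>D - {d}. f (b i))"
      have prod: "(\<Prod>i\<in>D. f ((b(d := k)) i)) = u * f k" for k
      proof -
        have "(\<Prod>i\<in>D - {d}. f ((b(d := k)) i)) = u"
          unfolding u_def by (intro prod.cong) auto
        then show ?thesis
          using d D by (simp add: prod.remove[of D d] mult.commute)
      qed
      have sum: "(\<Sum>i\<in>D. (b(d := k)) i) + b d = (\<Sum>i\<in>D. b i) + k" for k
      proof -
        have "(\<Sum>i\<in>D - {d}. (b(d := k)) i) = (\<Sum>i\<in>D - {d}. b i)"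
          by (intro sum.cong) auto
        then show ?thesis
          using d D by (simp add: sum.remove[of D d])
      qed
      have wsum: "(\<Sum>i\<in>D. (b(d := k)) i * i) + b d * d = (\<Sum>i\<in>D. b i * i) + k * d" for k
      proof -
        have "(\<Sum>i\<in>D - {d}. (b(d := k)) i * i) = (\<Sum>i\<in>D - {d}. b i * i)"
          by (intro sum.cong) auto
        then show ?thesis
          using d D by (simp add: sum.remove[of D d])
      qed
      have others: "u * f (n - i) * g i \<in> Q" if i: "i \<le> n" "i \<noteq> d" for i
      proof (cases "i \<in> D")
        case True
        have w: "w (b(d := n - i), i) = w p"
          using sum[of "n - i"] i by (simp add: w_def p n_def)
        have "e p < e (b(d := n - i), i)"
        proof -
          \<comment> \<open>As \<open>b d\<close> becomes \<open>b d + d - i\<close>, the sum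
            contributes \<open>2 * (d - i) * d\<close>, and adding \<open>i^2 - d^2\<close>
            completes the square. The integers are used because \<open>d - i\<close> may be
            negative.\<close>
          have "int (e (b(d := n - i), i)) - int (e p) =
              2 * (int (\<Sum>j\<in>D. (b(d := n - i)) j * j) - int (\<Sum>j\<in>D. b j * j)) + int i ^ 2 - int d ^ 2"
            by (simp add: e_def p)
          also have "int (\<Sum>j\<in>D. (b(d := n - i)) j * j) - int (\<Sum>j\<in>D. b j * j) =
              int (n - i) * int d - int (b d) * int d"
            using arg_cong[OF wsum[of "n - i"], of int] by simp
          also have "\<dots> = (int d - int i) * int d"
            using i by (simp add: n_def of_nat_diff algebra_simps)
          also have "2 * \<dots> + int i ^ 2 - int d ^ 2 = (int d - int i) ^ 2"
            by (simp add: power2_eq_square algebra_simps)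
          also have "\<dots> > 0"
            using i by simp
          finally show ?thesis by linarith
        qed
        with le[OF True, of "b(d := n - i)"] have "h (b(d := n - i), i) < h p"
          by (simp add: h_def w)
        with w have "((b(d := n - i), i), p) \<in> measures [w, h]"
          by simp
        with 1 True show ?thesis
          by (metis fst_conv snd_conv prod)
      next
        case False
        have "(\<Prod>j\<in>D. f ((b(d := n - i)) j)) * g i \<in> Q"
        proof (rule span[OF False])
          fix j assume j: "j \<in> D" "j < i"
          have "w (b(d := n - i), j) < w p"
            using sum[of "n - i"] i j by (simp add: w_def p n_def)
          then have "((b(d := n - i), j), p) \<in> measures [w, h]"
            by simp
          with 1 j show "(\<Prod>j\<in>D. f ((b(d := n - i)) j)) * g j \<in> Q"
            by (metis fst_conv snd_conv)
        qed
        then show ?thesis by (simp only: prod)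
      qed
      \<comment> \<open>The term for \<open>i = d\<close> is the product in question, since
        \<open>n - d = b d\<close>.\<close>
      have "u * (\<Sum>i\<le>n. f (n - i) * g i) = u * f (b d) * g d + (\<Sum>i\<in>{..n} - {d}. u * f (n - i) * g i)"
        by (subst sum.remove[of "{..n}" d]) (auto simp: n_def algebra_simps sum_distrib_left)
      moreover have "u * (\<Sum>i\<le>n. f (n - i) * g i) \<in> Q"
        unfolding u_def by (rule coeff[OF d])
      moreover have "(\<Sum>i\<in>{..n} - {d}. u * f (n - i) * g i) \<in> Q"
        using others by (intro idl.subspace_sum[OF Q]) auto
      ultimately have "u * f (b d) * g d \<in> Q"
        using idl.subspace_diff[OF Q] by (metis add_diff_cancel_right')
      then show ?thesis
        using prod[of "b d"] by simp
    qed
    then show ?case by (simp add: p)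
  qed
  from this[of "(b, d)"] show ?thesis
    using d by simp
qed

text \<open>Nakayama for the finitely generated ideal \<open>N\<close>, modulo \<open>K\<close>: the
  inclusion is only needed up to \<open>m N\<close>, that is, in \<open>Q = K + m N\<close>.\<close>

lemma local_Dedekind_Mertens_card_jumps:
  fixes f g :: "nat \<Rightarrow> 'a::comm_ring_1"
  assumes R: "noetherian_ring (\<R> :: 'a ring)" and m: "maximalideal m \<R>"
  defines "F \<equiv> idl.span (range f)" and "M \<equiv> idl.span (range g)"
    and "C \<equiv> idl.span (range (\<lambda>n. \<Sum>i\<le>n. f (n - i) * g i))"
  defines "p \<equiv> card (jumps (ideal_prod \<R> m M) g)"
  assumes fin: "finite (jumps (ideal_prod \<R> m M) g)" and p: "0 < p"
  shows "\<exists>s. s \<notin> m \<and> (\<forall>x\<in>ideal_prod \<R> (ideal_power \<R> F p) M.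
    s * x \<in> ideal_prod \<R> (ideal_power \<R> F (p - 1)) C)"
proof -
  define D where "D = jumps (ideal_prod \<R> m M) g"
  have D: "finite D" "p = card D"
    using fin by (auto simp: D_def p_def)
  define N where "N = ideal_prod \<R> (ideal_power \<R> F p) M"
  define K where "K = ideal_prod \<R> (ideal_power \<R> F (p - 1)) C"
  have N: "idl.subspace N" and K: "idl.subspace K" 
    by (simp_all add: N_def K_def F_def M_def C_def)
  define Q where "Q = idl.span (K \<union> ideal_prod \<R> m N)"
  have Q: "idl.subspace Q" by (simp add: Q_def)
  have f: "f n \<in> F" for n
    by (auto simp: F_def intro: idl.span_base)
  have prod: "(\<Prod>d\<in>D. f (b d)) \<in> ideal_power \<R> F p" for b
    unfolding D(2) using D(1) f by (intro prod_mem_ideal_power)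
  have span: "(\<Prod>d\<in>D. f (b d)) * g i \<in> Q"
    if "i \<notin> D" and Dm: "\<And>d. d \<in> D \<Longrightarrow> d < i \<Longrightarrow> (\<Prod>d\<in>D. f (b d)) * g d \<in> Q" for b i
  proof -
    let ?u = "\<Prod>d\<in>D. f (b d)"
    \<comment> \<open>A product of \<open>p\<close> coefficients of \<open>f\<close> carries
      \<open>m M\<close> into \<open>m N\<close>, so the error term in the span of the jumps is
      absorbed by \<open>Q\<close>.\<close>
    have "ideal_prod \<R> m M \<subseteq> {x. ?u * x \<in> Q}"
    proof (rule ideal_prod_subsetI[OF subspace_colon[OF Q]])
      fix a y assume "a \<in> m" "y \<in> M"
      then have "a * (?u * y) \<in> ideal_prod \<R> m N"
        unfolding N_def by (intro ideal_prodI prod)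
      then show "a * y \<in> {x. ?u * x \<in> Q}"
        by (auto simp: Q_def ac_simps intro: idl.span_base)
    qed
    then have "idl.span (g ` {d \<in> D. d < i} \<union> ideal_prod \<R> m M) \<subseteq> {x. ?u * x \<in> Q}"
      using Dm by (intro idl.span_minimal subspace_colon[OF Q]) auto
    then show ?thesis
      using mem_span_less_jumps[of i "ideal_prod \<R> m M" g] \<open>i \<notin> D\<close> by (auto simp: D_def)
  qed
  have jumps: "(\<Prod>i\<in>D. f (b i)) * g d \<in> Q" if "d \<in> D" for b d
  proof (rule products_mem[OF D(1) Q _ _ that])
    fix b :: "nat \<Rightarrow> nat" and d n assume d: "d \<in> D"
    \<comment> \<open>Omitting \<open>d\<close> leaves \<open>p - 1\<close> factors, which is the
      exponent in \<open>K\<close>.\<close>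
    have "(\<Prod>i\<in>D - {d}. f (b i)) \<in> ideal_power \<R> F (card (D - {d}))"
      using D f by (intro prod_mem_ideal_power) auto
    then have "(\<Prod>i\<in>D - {d}. f (b i)) * (\<Sum>i\<le>n. f (n - i) * g i) \<in> K"
      unfolding K_def using D d by (intro ideal_prodI) (auto simp: C_def intro: idl.span_base)
    then show "(\<Prod>i\<in>D - {d}. f (b i)) * (\<Sum>i\<le>n. f (n - i) * g i) \<in> Q"
      by (auto simp: Q_def intro: idl.span_base)
  qed (rule span)
  have "x * g i \<in> Q" if "x \<in> ideal_power \<R> F p" for x i
    using that unfolding F_def D(2)
  proof (rule ideal_power_mult_mem[OF D(1) Q])
    show "(\<Prod>d\<in>D. f (b d)) * g i \<in> Q" for b
      by (cases "i \<in> D") (auto intro: jumps span)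
  qed
  then have "M \<subseteq> {y. x * y \<in> Q}" if "x \<in> ideal_power \<R> F p" for x
    unfolding M_def using that by (intro idl.span_minimal subspace_colon[OF Q]) auto
  then have NQ: "N \<subseteq> Q"
    unfolding N_def by (intro ideal_prod_subsetI[OF Q]) auto
  obtain B where B: "finite B" "N = idl.span B"
    using noetherian_finite_span[OF R N] .
  have "B \<subseteq> N"
    unfolding B(2) by (rule idl.span_superset)
  then have "B \<subseteq> idl.span (K \<union> ideal_prod \<R> m (idl.span B))"
    using NQ unfolding Q_def B(2) by blast
  from Nakayama[OF m K B(1) this] obtain s where
    "s \<notin> m" "\<And>x. x \<in> N \<Longrightarrow> s * x \<in> K"
    unfolding B(2) by blast
  then show ?thesis
    unfolding N_def K_def by blast
qed

text \<open>There are \<open>p \<le> k\<close> jumps, and multiplying the formula for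
  \<open>p\<close> by \<open>F^(k - p)\<close> gives that for \<open>k\<close>. For
  \<open>p = 0\<close> the exponent \<open>p - 1\<close> makes no sense, so this case is treated
  apart.\<close>

lemma local_Dedekind_Mertens:
  fixes f g :: "nat \<Rightarrow> 'a::comm_ring_1"
  assumes R: "noetherian_ring (\<R> :: 'a ring)" and m: "maximalideal m \<R>"
  defines "F \<equiv> idl.span (range f)" and "M \<equiv> idl.span (range g)"
    and "C \<equiv> idl.span (range (\<lambda>n. \<Sum>i\<le>n. f (n - i) * g i))"
  assumes E: "finite E" "E \<subseteq> M" "card E \<le> k" "\<And>i. \<exists>s. s \<notin> m \<and> s * g i \<in> idl.span E"
    and k: "0 < k"
  shows "\<exists>s. s \<notin> m \<and> (\<forall>x\<in>ideal_prod \<R> (ideal_power \<R> F k) M.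
    s * x \<in> ideal_prod \<R> (ideal_power \<R> F (k - 1)) C)"
proof -
  define D where "D = jumps (ideal_prod \<R> m M) g"
  define p where "p = card D"
  define K where "K = ideal_prod \<R> (ideal_power \<R> F (k - 1)) C"
  note mx = maximalideal_ring_ofD[OF m]
  have F: "idl.subspace F" and M: "idl.subspace M" and C: "idl.subspace C"
    by (simp_all add: F_def M_def C_def)
  have K: "idl.subspace K"
    using F C by (simp add: K_def)
  have "range g \<subseteq> M"
    unfolding M_def by (rule idl.span_superset)
  from card_jumps_le[OF m E(1,2) this E(4)] E(3) have D: "finite D" "p \<le> k"
    by (auto simp: D_def p_def)
  have "\<exists>s. s \<notin> m \<and> (\<forall>x\<in>ideal_prod \<R> (ideal_power \<R> F k) M. s * x \<in> K)"
  proof (cases "p = 0")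
    case True
    then have "D = {}" using D by (simp add: p_def)
    \<comment> \<open>Without jumps \<open>M = m M\<close>, so Nakayama with \<open>Q = {0}\<close>
      yields a multiplier outside \<open>m\<close> that annihilates \<open>M\<close>.\<close>
    then have "g i \<in> idl.span ({0} \<union> ideal_prod \<R> m M)" for i
      using mem_span_jumps[of g i "ideal_prod \<R> m M"]
        idl.span_mono[of "ideal_prod \<R> m M" "{0} \<union> ideal_prod \<R> m M"]
      by (auto simp: D_def)
    then have "M \<subseteq> idl.span ({0} \<union> ideal_prod \<R> m M)"
      unfolding M_def by (intro idl.span_minimal) auto
    moreover obtain B where B: "finite B" "M = idl.span B"
      using noetherian_finite_span[OF R M] .
    ultimately have "B \<subseteq> idl.span ({0} \<union> ideal_prod \<R> m (idl.span B))"
      using idl.span_superset[of B] by auto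
    from Nakayama[OF m _ B(1) this] obtain s where s: "s \<notin> m" "\<And>x. x \<in> M \<Longrightarrow> s * x = 0"
      unfolding B(2) by auto
    have "ideal_prod \<R> (ideal_power \<R> F k) M \<subseteq> {x. s * x \<in> K}"
    proof (rule ideal_prod_subsetI[OF subspace_colon[OF K]])
      fix x y assume "y \<in> M"
      then have "s * (x * y) = 0"
        using s(2)[of y] by (metis mult.left_commute mult_zero_right)
      then show "x * y \<in> {x. s * x \<in> K}"
        using idl.subspace_0[OF K] by simp
    qed
    then show ?thesis using s(1) by blast
  next
    case False
    then have p: "0 < p" by simp
    have "\<exists>s. s \<notin> m \<and> (\<forall>x\<in>ideal_prod \<R> (ideal_power \<R> F p) M.
        s * x \<in> ideal_prod \<R> (ideal_power \<R> F (p - 1)) C)"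
      using D(1) p unfolding D_def p_def M_def F_def C_def
      by (rule local_Dedekind_Mertens_card_jumps[OF R m])
    then obtain s where s: "s \<notin> m"
      "\<And>x. x \<in> ideal_prod \<R> (ideal_power \<R> F p) M \<Longrightarrow> s * x \<in> ideal_prod \<R> (ideal_power \<R> F (p - 1)) C"
      by blast
    interpret R: cring "\<R> :: 'a ring" by (rule cring_from_type_algebra)
    note assoc = R.ideal_prod_assoc[unfolded ideal_ring_of_iff]
    have "ideal_power \<R> F k = ideal_prod \<R> (ideal_power \<R> F (k - p)) (ideal_power \<R> F p)"
      using ideal_power_add[OF F, of "k - p" p] D(2) by simp
    then have 1: "ideal_prod \<R> (ideal_power \<R> F k) M =
        ideal_prod \<R> (ideal_power \<R> F (k - p)) (ideal_prod \<R> (ideal_power \<R> F p) M)"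
      using F M by (simp add: assoc)
    have "ideal_power \<R> F (k - 1) =
        ideal_prod \<R> (ideal_power \<R> F (k - p)) (ideal_power \<R> F (p - 1))"
      using ideal_power_add[OF F, of "k - p" "p - 1"] D(2) p by simp
    then have 2: "K = ideal_prod \<R> (ideal_power \<R> F (k - p)) (ideal_prod \<R> (ideal_power \<R> F (p - 1)) C)"
      using F C by (simp add: K_def assoc)
    have "ideal_prod \<R> (ideal_power \<R> F k) M \<subseteq> {x. s * x \<in> K}"
      unfolding 1
    proof (rule ideal_prod_subsetI[OF subspace_colon[OF K]])
      fix x y
      assume "x \<in> ideal_power \<R> F (k - p)" "y \<in> ideal_prod \<R> (ideal_power \<R> F p) M"
      then have "x * (s * y) \<in> K"
        unfolding 2 by (intro ideal_prodI s(2))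
      then show "x * y \<in> {x. s * x \<in> K}"
        by (simp add: ac_simps)
    qed
    then show ?thesis using s(1) by blast
  qed
  then show ?thesis
    unfolding K_def .
qed

section \<open>Generators of localized ideals\<close>

context mult_submonoid
begin

lemma loc_idealI: "a \<in> I \<Longrightarrow> s \<in> S \<Longrightarrow> loc_frac R S a s \<in> loc_ideal R S I"
  by (auto simp: loc_ideal_def)

lemma loc_ideal_ideal:
  assumes "ideal I R"
  shows "ideal (loc_ideal R S I) (localization R S)"
proof -
  define L where "L = localization R S"
  interpret I: ideal I R by fact
  interpret L: cring L
    unfolding L_def by (rule cring_localization)
  have carr: "x \<in> carrier L" if "x \<in> loc_ideal R S I" for x
    using that I.Icarr by (auto simp: loc_ideal_def L_def)
  have mult: "y \<otimes>\<^bsub>L\<^esub> x \<in> loc_ideal R S I" if x: "x \<in> loc_ideal R S I" and y: "y \<in> carrier L" for x y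
  proof -
    obtain a s where as: "a \<in> I" "s \<in> S" "x = loc_frac R S a s"
      using x by (auto simp: loc_ideal_def)
    obtain b t where bt: "b \<in> carrier R" "t \<in> S" "y = loc_frac R S b t"
      using y unfolding L_def by (rule localization_carrierE)
    have "y \<otimes>\<^bsub>L\<^esub> x = loc_frac R S (b \<otimes> a) (t \<otimes> s)"
      using as bt I.Icarr by (simp add: L_def localization_mult)
    then show ?thesis
      using as bt I.I_l_closed by (simp add: loc_idealI)
  qed
  have "ideal (loc_ideal R S I) L"
  proof (rule idealI)
    show "subgroup (loc_ideal R S I) (add_monoid L)"
    proof (rule L.add.subgroupI)
      show "loc_ideal R S I \<subseteq> carrier L"
        using carr by blast
      show "loc_ideal R S I \<noteq> {}"
        using loc_idealI[OF I.zero_closed, of \<one>] by auto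
      show "\<ominus>\<^bsub>L\<^esub> x \<in> loc_ideal R S I" if "x \<in> loc_ideal R S I" for x
        using mult[OF that, of "\<ominus>\<^bsub>L\<^esub> \<one>\<^bsub>L\<^esub>"] carr[OF that] by (simp add: L.l_minus)
      show "x \<oplus>\<^bsub>L\<^esub> y \<in> loc_ideal R S I" if xy: "x \<in> loc_ideal R S I" "y \<in> loc_ideal R S I" for x y
      proof -
        obtain a s b t where ab: "a \<in> I" "s \<in> S" "x = loc_frac R S a s"
          "b \<in> I" "t \<in> S" "y = loc_frac R S b t"
          using xy by (auto simp: loc_ideal_def)
        then have "x \<oplus>\<^bsub>L\<^esub> y = loc_frac R S (a \<otimes> t \<oplus> b \<otimes> s) (s \<otimes> t)"
          using I.Icarr by (simp add: L_def localization_add)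
        moreover have "a \<otimes> t \<oplus> b \<otimes> s \<in> I"
          using ab by (intro I.a_closed I.I_r_closed) auto
        ultimately show ?thesis
          using ab by (auto simp: loc_ideal_def)
      qed
    qed
    show "ring L" by (rule L.ring_axioms)
    show "y \<otimes>\<^bsub>L\<^esub> x \<in> loc_ideal R S I" if "x \<in> loc_ideal R S I" "y \<in> carrier L" for x y
      using that by (rule mult)
    show "x \<otimes>\<^bsub>L\<^esub> y \<in> loc_ideal R S I" if "x \<in> loc_ideal R S I" "y \<in> carrier L" for x y
      using mult[OF that] carr[OF that(1)] that(2) by (simp add: L.m_comm)
  qed
  then show ?thesis by (simp add: L_def)
qed

text \<open>The contraction \<open>T\<close> of the ideal on the right is an ideal containing
  \<open>A\<close>, hence all of \<open>genideal R A\<close>; a general fraction is then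
  \<open>a/s = (1/s) (a/1)\<close>. The other inclusion is minimality.\<close>

lemma loc_ideal_genideal:
  assumes A: "A \<subseteq> carrier R"
  shows "loc_ideal R S (genideal R A) = genideal (localization R S) ((\<lambda>a. loc_frac R S a \<one>) ` A)"
proof -
  define L where "L = localization R S"
  interpret L: cring L
    unfolding L_def by (rule cring_localization)
  interpret A: ideal "genideal R A" R
    using A by (rule genideal_ideal)
  define A' where "A' = (\<lambda>a. loc_frac R S a \<one>) ` A"
  have A': "A' \<subseteq> carrier L"
    using A by (auto simp: A'_def L_def)
  interpret K: ideal "genideal L A'" L
    using A' by (rule L.genideal_ideal)
  have fmult: "loc_frac R S (b \<otimes> a) \<one> = loc_frac R S b \<one> \<otimes>\<^bsub>L\<^esub> loc_frac R S a \<one>"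
    and fadd: "loc_frac R S (b \<oplus> a) \<one> = loc_frac R S b \<one> \<oplus>\<^bsub>L\<^esub> loc_frac R S a \<one>"
    if "a \<in> carrier R" "b \<in> carrier R" for a b
    using that by (simp_all add: L_def localization_mult localization_add)
  define T where "T = {x \<in> carrier R. loc_frac R S x \<one> \<in> genideal L A'}"
  have mult: "a \<otimes> x \<in> T" if "x \<in> T" "a \<in> carrier R" for a x
    using that K.I_l_closed[of "loc_frac R S x \<one>" "loc_frac R S a \<one>"]
    by (auto simp: T_def fmult L_def)
  have "ideal T R"
  proof (rule idealI)
    show "subgroup T (add_monoid R)"
    proof (rule add.subgroupI)
      show "T \<noteq> {}"
        using K.zero_closed by (auto simp: T_def L_def localization_zero)
      show "\<ominus> x \<in> T" if "x \<in> T" for x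
        using mult[OF that, of "\<ominus> \<one>"] that by (simp add: l_minus T_def)
      show "x \<oplus> y \<in> T" if "x \<in> T" "y \<in> T" for x y
        using that by (auto simp: T_def fadd intro: K.a_closed)
    qed (auto simp: T_def)
    show "ring R" by (rule ring_axioms)
    show "y \<otimes> x \<in> T" if "x \<in> T" "y \<in> carrier R" for x y
      using that by (rule mult)
    show "x \<otimes> y \<in> T" if "x \<in> T" "y \<in> carrier R" for x y
      using mult[OF that] that by (simp add: m_comm T_def)
  qed
  moreover have "A \<subseteq> T"
    using A L.genideal_self[OF A'] by (auto simp: T_def A'_def)
  ultimately have AT: "genideal R A \<subseteq> T"
    by (rule genideal_minimal)
  have "loc_ideal R S (genideal R A) \<subseteq> genideal L A'"
  proof
    fix x assume "x \<in> loc_ideal R S (genideal R A)"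
    then obtain a s where as: "a \<in> genideal R A" "s \<in> S" "x = loc_frac R S a s"
      by (auto simp: loc_ideal_def)
    then have a: "a \<in> carrier R" "loc_frac R S a \<one> \<in> genideal L A'"
      using AT by (auto simp: T_def)
    then have "loc_frac R S \<one> s \<otimes>\<^bsub>L\<^esub> loc_frac R S a \<one> \<in> genideal L A'"
      using as(2) by (intro K.I_l_closed) (auto simp: L_def)
    then show "x \<in> genideal L A'"
      using as a(1) by (simp add: L_def localization_mult)
  qed
  moreover have "genideal L A' \<subseteq> loc_ideal R S (genideal R A)"
  proof (rule L.genideal_minimal)
    show "ideal (loc_ideal R S (genideal R A)) L"
      unfolding L_def by (rule loc_ideal_ideal) (rule A.is_ideal)
    show "A' \<subseteq> loc_ideal R S (genideal R A)"
      using genideal_self[OF A] by (auto simp: A'_def intro!: loc_idealI)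
  qed
  ultimately show ?thesis
    by (auto simp: L_def A'_def)
qed

end

lemma mult_submonoid_compl_maximalideal:
  assumes "maximalideal m \<R>"
  shows "mult_submonoid \<R> (UNIV - m)"
  using cring.mult_submonoid_compl_primeideal[OF cring_from_type_algebra, of m]
    cring.maximalideal_prime[OF cring_from_type_algebra assms] by simp

text \<open>The first part bounds the local numbers of generators uniformly in \<open>m\<close>. The
  second clears denominators: numerators of local generators generate \<open>I\<close> up to
  multipliers outside \<open>m\<close>.\<close>

lemma min_gens_localization_at:
  fixes m :: "'a::comm_ring_1 set"
  assumes m: "maximalideal m \<R>" and B: "finite B"
  defines "L \<equiv> localization_at \<R> m" and "I \<equiv> idl.span B"
  shows "min_gens L (ideal_at \<R> m I) \<le> card B"
    and "\<exists>E\<subseteq>I. finite E \<and> card E \<le> min_gens L (ideal_at \<R> m I) \<and>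
      (\<forall>x\<in>I. \<exists>s. s \<notin> m \<and> s * x \<in> idl.span E)"
proof -
  define S where "S = UNIV - m"
  interpret mult_submonoid "\<R> :: 'a ring" S
    unfolding S_def using m by (rule mult_submonoid_compl_maximalideal)
  note mx = maximalideal_ring_ofD[OF m]
  have L: "L = localization \<R> S" "ideal_at \<R> m I = loc_ideal \<R> S I"
    by (simp_all add: L_def S_def)
  define P where "P = (\<lambda>n. \<exists>A\<subseteq>carrier L. finite A \<and> card A = n \<and> loc_ideal \<R> S I = genideal L A)"
  have min_gens: "min_gens L (ideal_at \<R> m I) = (LEAST n. P n)"
    unfolding L(2) min_gens_def P_def by (rule refl)
  define A0 where "A0 = (\<lambda>b. loc_frac \<R> S b 1) ` B"
  have "1 \<in> S"
    using mx(2) by (simp add: S_def)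
  then have "A0 \<subseteq> carrier L"
    using loc_frac_closed[of _ 1] by (auto simp: A0_def L)
  moreover have "loc_ideal \<R> S I = genideal L A0"
    using loc_ideal_genideal[of B] by (simp add: A0_def L I_def genideal_ring_of)
  ultimately have P: "P (card A0)"
    unfolding P_def using B by (intro exI[of _ A0]) (simp add: A0_def)
  have "(LEAST n. P n) \<le> card A0"
    by (rule Least_le) (rule P)
  also have "\<dots> \<le> card B"
    unfolding A0_def using B by (rule card_image_le)
  finally show "min_gens L (ideal_at \<R> m I) \<le> card B"
    by (simp only: min_gens)
  have "P (LEAST n. P n)"
    by (rule LeastI) (rule P)
  then obtain A where A: "A \<subseteq> carrier L" "finite A" "card A = (LEAST n. P n)"
    "loc_ideal \<R> S I = genideal L A"
    by (auto simp: P_def)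
  interpret L: cring L
    unfolding L by (rule cring_localization)
  have "\<forall>a\<in>A. \<exists>e. e \<in> I \<and> (\<exists>s. s \<in> S \<and> a = loc_frac \<R> S e s)"
    using L.genideal_self[OF A(1)] unfolding A(4)[symmetric] by (auto simp: loc_ideal_def)
  then obtain e where e: "\<And>a. a \<in> A \<Longrightarrow> e a \<in> I \<and> (\<exists>s. s \<in> S \<and> a = loc_frac \<R> S (e a) s)"
    by metis
  define E where "E = e ` A"
  \<comment> \<open>The saturation of the span of \<open>E\<close>. Its localization contains the
    generators \<open>A\<close>, hence the whole localization of \<open>I\<close>.\<close>
  define J where "J = {x. \<exists>t. t \<notin> m \<and> t * x \<in> idl.span E}"
  have "idl.subspace J"
  proof (rule idl.subspaceI)
    show "0 \<in> J"
      using mx(2) by (auto simp: J_def idl.span_zero)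
    show "x + y \<in> J" if "x \<in> J" "y \<in> J" for x y
    proof -
      obtain s t where st: "s \<notin> m" "t \<notin> m" "s * x \<in> idl.span E" "t * y \<in> idl.span E"
        using \<open>x \<in> J\<close> \<open>y \<in> J\<close> by (auto simp: J_def)
      then have "t * (s * x) + s * (t * y) \<in> idl.span E"
        by (simp add: idl.span_add idl.span_scale)
      then show ?thesis
        using mx(4)[OF st(1,2)]
        unfolding J_def by (intro CollectI exI[of _ "s * t"]) (simp add: algebra_simps)
    qed
    show "c * x \<in> J" if "x \<in> J" for c x
      using that idl.span_scale[of _ E c] by (auto simp: J_def mult.left_commute[of _ c])
  qed
  then have "ideal (loc_ideal \<R> S J) L"
    unfolding L by (intro loc_ideal_ideal) (simp add: ideal_ring_of_iff)
  moreover have "A \<subseteq> loc_ideal \<R> S J"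
  proof
    fix a assume "a \<in> A"
    moreover from this have "e a \<in> J"
      using mx(2) by (auto simp: J_def E_def intro!: exI[of _ 1] idl.span_base)
    ultimately show "a \<in> loc_ideal \<R> S J"
      using e[OF \<open>a \<in> A\<close>] unfolding loc_ideal_def by blast
  qed
  ultimately have sub: "loc_ideal \<R> S I \<subseteq> loc_ideal \<R> S J"
    unfolding A(4) by (rule L.genideal_minimal)
  have "\<exists>s. s \<notin> m \<and> s * x \<in> idl.span E" if "x \<in> I" for x
  proof -
    have "loc_frac \<R> S x 1 \<in> loc_ideal \<R> S J"
      using sub that mx(2) by (auto simp: loc_ideal_def S_def)
    then obtain y s where ys: "y \<in> J" "s \<in> S" "loc_frac \<R> S x 1 = loc_frac \<R> S y s"
      by (auto simp: loc_ideal_def)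
    \<comment> \<open>Equality of \<open>x/1\<close> and \<open>y/s\<close> holds in the ring only
      up to a factor \<open>u\<close> outside \<open>m\<close>, which therefore enters the
      multiplier \<open>t * u * s\<close>.\<close>
    then obtain u where u: "u \<in> S" "u * (x * s) = u * y"
      using loc_frac_eq_iff[of x 1 y s] mx(2) by (auto simp: S_def)
    obtain t where t: "t \<notin> m" "t * y \<in> idl.span E"
      using ys(1) by (auto simp: J_def)
    have "t * u * s \<notin> m"
      using t(1) u(1) ys(2) mx(4) by (auto simp: S_def)
    moreover have "t * u * s * x = u * (t * y)"
      using u(2) by (metis mult.assoc mult.commute)
    ultimately show ?thesis
      using idl.span_scale[OF t(2), of u] by metis
  qed
  moreover have "E \<subseteq> I" "finite E" "card E \<le> card A"
    using e A(2) card_image_le[OF A(2), of e] by (auto simp: E_def)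
  ultimately show "\<exists>E\<subseteq>I. finite E \<and> card E \<le> min_gens L (ideal_at \<R> m I) \<and>
      (\<forall>x\<in>I. \<exists>s. s \<notin> m \<and> s * x \<in> idl.span E)"
    unfolding min_gens A(3)[symmetric] by blast
qed

section \<open>Contents of power series\<close>

lemma fps_content_eq: "fps_content f = idl.span (range (fps_nth f))"
  by (simp add: fps_content_def genideal_ring_of)

lemma fps_content_mult_eq:
  "fps_content (f * g) = idl.span (range (\<lambda>n. \<Sum>i\<le>n. fps_nth f (n - i) * fps_nth g i))"
proof -
  have "fps_nth (f * g) n = (\<Sum>i\<le>n. fps_nth f (n - i) * fps_nth g i)" for n
    unfolding mult.commute[of f g] fps_mult_nth atMost_atLeast0
    by (intro sum.cong refl mult.commute)
  then show ?thesis
    by (simp add: fps_content_eq)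
qed

text \<open>The formulas at the maximal ideals are glued by \<open>mem_if_locally_mem\<close>; the
  sets \<open>E\<close> they require come from \<open>min_gens_localization_at\<close>.\<close>

theorem fps_Dedekind_Mertens:
  fixes f g :: "'a::comm_ring_1 fps"
  assumes R: "noetherian_ring (\<R> :: 'a ring)" and k: "0 < k"
    and min_gens: "\<And>m. maximalideal m \<R> \<Longrightarrow>
      min_gens (localization_at \<R> m) (ideal_at \<R> m (fps_content g)) \<le> k"
  shows "ideal_prod \<R> (ideal_power \<R> (fps_content f) k) (fps_content g)
    \<subseteq> ideal_prod \<R> (ideal_power \<R> (fps_content f) (k - 1)) (fps_content (f * g))"
proof
  fix x assume x: "x \<in> ideal_prod \<R> (ideal_power \<R> (fps_content f) k) (fps_content g)"
  have sub: "idl.subspace (fps_content h)" for h :: "'a fps"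
    by (simp add: fps_content_eq)
  obtain B where B: "finite B" "fps_content g = idl.span B"
    using noetherian_finite_span[OF R sub] .
  show "x \<in> ideal_prod \<R> (ideal_power \<R> (fps_content f) (k - 1)) (fps_content (f * g))"
  proof (rule mem_if_locally_mem[OF R])
    fix m :: "'a set" assume m: "maximalideal m \<R>"
    obtain E where E: "E \<subseteq> fps_content g" "finite E" "card E \<le> k"
      "\<And>x. x \<in> fps_content g \<Longrightarrow> \<exists>s. s \<notin> m \<and> s * x \<in> idl.span E"
      using min_gens_localization_at(2)[OF m B(1)] min_gens[OF m]
      unfolding B(2) by (meson le_trans)
    have "\<exists>s. s \<notin> m \<and> s * fps_nth g i \<in> idl.span E" for i
      by (rule E(4)) (auto simp: fps_content_eq intro: idl.span_base)
    with E have "\<exists>s. s \<notin> m \<and> (\<forall>x\<in>ideal_prod \<R> (ideal_power \<R> (fps_content f) k) (fps_content g).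
        s * x \<in> ideal_prod \<R> (ideal_power \<R> (fps_content f) (k - 1)) (fps_content (f * g)))"
      unfolding fps_content_mult_eq fps_content_eq[of f] fps_content_eq[of g]
      by (intro local_Dedekind_Mertens[OF R m _ _ _ _ k])
    with x show "\<exists>s. s \<notin> m \<and> s * x \<in> ideal_prod \<R> (ideal_power \<R> (fps_content f) (k - 1)) (fps_content (f * g))"
      by blast
  qed (simp add: sub)
qed

section \<open>Reduction of the product of the contents\<close>

theorem corollary2p7:
  fixes R :: "'a::comm_ring_1 ring" and f g :: "'a fps" and k :: nat
  assumes "R = ring_of_type_algebra"
    and "noetherian_ring R"
    and "g \<noteq> 0"
    and "k = Max {min_gens (localization_at R m) (ideal_at R m (fps_content g)) | m. maximalideal m R}"
  shows "is_reduction R (fps_content (f * g)) (ideal_prod R (fps_content f) (fps_content g)) \<and>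
    int (reduction_number R (fps_content (f * g)) (ideal_prod R (fps_content f) (fps_content g)))
      \<le> int k - 1"
proof -
  have R: "noetherian_ring (\<R> :: 'a ring)" using assms by simp
  interpret R: cring "\<R> :: 'a ring" by (rule cring_from_type_algebra)
  define F where "F = fps_content f"
  define M where "M = fps_content g"
  define C where "C = fps_content (f * g)"
  have sub [simp]: "idl.subspace F" "idl.subspace M" "idl.subspace C"
    by (simp_all add: F_def M_def C_def fps_content_eq)
  obtain B where B: "finite B" "M = idl.span B"
    using noetherian_finite_span[OF R sub(2)] .
  define \<mu> where "\<mu> = (\<lambda>m. min_gens (localization_at \<R> m) (ideal_at \<R> m M))"
  have k: "k = Max {\<mu> m | m. maximalideal m \<R>}"
    by (simp add: assms \<mu>_def M_def)
  \<comment> \<open>The uniform bound \<open>card B\<close> makes the set finite, as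
    \<open>Max_ge\<close> requires.\<close>
  have "{\<mu> m | m. maximalideal m \<R>} \<subseteq> {..card B}"
    using min_gens_localization_at(1)[OF _ B(1)] by (auto simp: \<mu>_def B(2))
  then have "finite {\<mu> m | m. maximalideal m \<R>}"
    by (rule finite_subset) simp
  then have \<mu>_le: "\<mu> m \<le> k" if "maximalideal m \<R>" for m
    unfolding k using that by (intro Max_ge) auto
  \<comment> \<open>For \<open>k = 0\<close> each \<open>E\<close> is empty, so every coefficient of
    \<open>g\<close> is locally zero and hence zero, against \<open>g \<noteq> 0\<close>. Thus
    \<open>k - 1\<close> is a natural number, called \<open>r\<close> below.\<close>
  have "0 < k"
  proof (rule ccontr)
    assume "\<not> 0 < k"
    have "fps_nth g i \<in> {0}" for i
    proof (rule mem_if_locally_mem[OF R])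
      fix m :: "'a set" assume m: "maximalideal m \<R>"
      have "fps_nth g i \<in> M"
        by (auto simp: M_def fps_content_eq intro: idl.span_base)
      then obtain E where "finite E" "card E \<le> \<mu> m" "\<exists>s. s \<notin> m \<and> s * fps_nth g i \<in> idl.span E"
        using min_gens_localization_at(2)[OF m B(1)] by (auto simp: \<mu>_def B(2))
      then show "\<exists>s. s \<notin> m \<and> s * fps_nth g i \<in> {0}"
        using \<mu>_le[OF m] \<open>\<not> 0 < k\<close> by auto
    qed simp
    then show False
      using \<open>g \<noteq> 0\<close> by (auto simp: fps_eq_iff)
  qed
  then obtain r where r: "k = Suc r" by (cases k) auto
  let ?P = "ideal_prod \<R>"
  note comm = R.ideal_prod_commute[unfolded ideal_ring_of_iff]
  note assoc = R.ideal_prod_assoc[unfolded ideal_ring_of_iff]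
  have mono: "?P I J \<subseteq> ?P I' J'" if "I \<subseteq> I'" "J \<subseteq> J'" "idl.subspace I'" "idl.subspace J'"
    for I J I' J' :: "'a set"
    using that by (intro ideal_prod_subsetI) (auto intro: ideal_prodI)
  have formula: "?P (ideal_power \<R> F (Suc r)) M \<subseteq> ?P (ideal_power \<R> F r) C"
    using fps_Dedekind_Mertens[OF R \<open>0 < k\<close>, of g f] \<mu>_le by (simp add: F_def M_def C_def \<mu>_def r)
  have CI: "C \<subseteq> ?P F M"
    unfolding C_def fps_content_mult_eq
  proof (rule idl.span_minimal)
    show "range (\<lambda>n. \<Sum>i\<le>n. fps_nth f (n - i) * fps_nth g i) \<subseteq> ?P F M"
      by (auto simp: F_def M_def fps_content_eq intro!: idl.subspace_sum ideal_prodI idl.span_base)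
  qed simp
  let ?I = "?P F M"
  \<comment> \<open>The formula multiplied by \<open>M^r\<close>: \<open>(F M)^(r+1) = F^(r+1) M M^r
    \<subseteq> F^r C M^r = C (F M)^r\<close>. The reverse inclusion comes from
    \<open>C \<subseteq> F M\<close>.\<close>
  have red: "ideal_power \<R> ?I (r + 1) = ?P C (ideal_power \<R> ?I r)"
  proof
    have "ideal_power \<R> ?I (r + 1) = ?P (ideal_power \<R> F (Suc r)) (?P M (ideal_power \<R> M r))"
      using ideal_power_prod[of F M "Suc r"] by simp
    also have "\<dots> = ?P (?P (ideal_power \<R> F (Suc r)) M) (ideal_power \<R> M r)"
      by (rule assoc[symmetric]) auto
    also have "\<dots> \<subseteq> ?P (?P (ideal_power \<R> F r) C) (ideal_power \<R> M r)"
      by (intro mono formula) auto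
    also have "\<dots> = ?P (?P C (ideal_power \<R> F r)) (ideal_power \<R> M r)"
      by (subst comm) auto
    also have "\<dots> = ?P C (ideal_power \<R> ?I r)"
      by (simp add: ideal_power_prod assoc)
    finally show "ideal_power \<R> ?I (r + 1) \<subseteq> ?P C (ideal_power \<R> ?I r)" .
    show "?P C (ideal_power \<R> ?I r) \<subseteq> ideal_power \<R> ?I (r + 1)"
      using mono[OF CI] by simp
  qed
  have "is_reduction \<R> C ?I"
    unfolding is_reduction_def using red CI by (auto simp: ideal_ring_of_iff)
  moreover have "reduction_number \<R> C ?I \<le> r"
    unfolding reduction_number_def using red by (rule Least_le)
  ultimately show ?thesis
    by (simp add: assms(1) F_def M_def C_def r)
qed

end
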